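(* Let $\mathbb{H}$ be an elementary abelian $2$-hypergroup, the constrained direct product of $\langle q_1\rangle,\dots,\langle q_p\rangle$ with $q_1,\dots,q_p$ involutions of $\mathbb{H}$, and let $p^\sharp$ be the number of thick elements of $\mathbb{H}$ contained in $\{q_1,\dots,q_p\}$. Let $\mathbb{F}$ and $\mathbb{G}$ be closed subsets of $\mathbb{H}$. Then $\mathbb{F}\simeq\mathbb{G}$ if and only if at least two of the equalities $\mathrm{s}(\mathbb{F})=\mathrm{s}(\mathbb{G})$, $\mathrm{r}_2(\mathbb{F})=\mathrm{r}_2(\mathbb{G})$, and $|\mathbb{F}|=|\mathbb{G}|$ hold. Moreover, there are exactly $pp^\sharp-(p^\sharp)^2+p+1$ pairwise distinct $\simeq$-equivalence classes (on the set of all closed subsets of $\mathbb{H}$). The cardinality of the $\simeq$-equivalence class containing $\mathbb{F}$ is equal to $$\binom{p^\sharp}{\mathrm{s}(\mathbb{F})}\binom{p-p^\sharp}{\mathrm{r}_2(\mathbb{F})}_2.$$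
   Context: A hypergroup is a nonempty set $\mathbb{H}$ with a hypermultiplication $(a,b)\mapsto ab\subseteq\mathbb{H}$ and a map $a\mapsto a^*$ from $\mathbb{H}$ to $\mathbb{H}$ such that, writing $\mathbb{F}\mathbb{G}=\bigcup_{b\in\mathbb{F},c\in\mathbb{G}}bc$ for $\mathbb{F},\mathbb{G}\subseteq\mathbb{H}$ and $a\mathbb{G}=\{a\}\mathbb{G}$, $\mathbb{G}a=\mathbb{G}\{a\}$: (1) $(ab)c=a(bc)$ for all $a,b,c$; (2) there is a unique $e\in\mathbb{H}$ with $ea=\{a\}=ae$ for all $a$; (3) for all $a,b,c$ the conditions $a\in bc$, $b\in ac^*$, $c\in b^*a$ are pairwise equivalent. A nonempty $\mathbb{G}\subseteq\mathbb{H}$ is a closed subset of $\mathbb{H}$ if $\mathbb{G}^*\mathbb{G}\subseteq\mathbb{G}$, where $\mathbb{G}^*=\{a^*:a\in\mathbb{G}\}$. $\langle a\rangle$ is the intersection of all closed subsets of $\mathbb{H}$ containing $a$. An element $a$ is thin if $a^*a=\{e\}$ and thick otherwise. A closed subset is thin if all its elements are thin. A closed subset $\mathbb{F}$ of $\mathbb{H}$ is normal in $\mathbb{H}$ if $\mathbb{F}a=a\mathbb{F}$ for all $a\in\mathbb{H}$. An involution is an element $a\neq e$ such that $\{e,a\}$ is closed. If $a,b$ are thin, then $ab$ is a singleton $\{c\}$ with $c$ thin; for a thin closed subset $\mathbb{G}$, $\mathbb{G}^\gamma=\{\{a\}:a\in\mathbb{G}\}$ is a group under $\{a\}\bullet\{b\}=ab$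 with identity $\{e\}$, and the $2$-rank of a finite thin closed subset $\mathbb{G}$ is the $2$-rank of $\mathbb{G}^\gamma$. For a finite closed subset $\mathbb{G}$, $\mathrm{r}_2(\mathbb{G})$ is the largest $2$-rank of a thin closed subset of $\mathbb{H}$ contained in $\mathbb{G}$. Elementary abelian $2$-hypergroups: $\mathbb{H}$ is the direct product of normal closed subsets $\mathbb{G}_1,\dots,\mathbb{G}_p$ ($p\geq 1$) if, for each $i$, $\mathbb{H}=\mathbb{G}_i\widehat{\mathbb{G}_i}$ and $\mathbb{G}_i\cap\widehat{\mathbb{G}_i}=\{e\}$, where $\widehat{\mathbb{G}_i}=\prod_{j\neq i}\mathbb{G}_j$ (and $\widehat{\mathbb{G}_1}=\{e\}$ if $p=1$). Then for every $a\in\mathbb{H}$ there are unique $r_i\in\mathbb{G}_i$ ($1\le i\le p$) with $a\in r_1r_2\cdots r_p$; the set $\{r_1,\dots,r_p\}\setminus\{e\}$ is the support of $a$. The direct product is constrained if $r_1r_2\cdots r_p=\{a\}$ for every $a\in\mathbb{H}$. $\mathbb{H}$ is an elementary abelian $2$-hypergroup if it is the constrained direct product of closed subsets $\langle q_1\rangle,\dots,\langle q_p\rangle$ with $q_1,\dots,q_p$ involutions of $\mathbb{H}$ (so $\langle q_i\rangle=\{e,q_i\}$); supports are taken with respect to this fixed decomposition. For $a\in\mathbb{H}$, $\mathrm{s}(a)$ is the number of thick elements in the support of $a$; for a closed subset $\mathbb{G}$, $\mathrm{s}(\mathbb{G})=\max\{\mathrm{s}(a):a\in\mathbb{G}\}$.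 A homomorphism between closed subsets $\mathbb{F},\mathbb{G}$ of $\mathbb{H}$ is a map $\alpha:\mathbb{F}\to\mathbb{G}$ with $e^\alpha=e$ and $(ab)^\alpha=a^\alpha b^\alpha$ for all $a,b\in\mathbb{F}$, where $(ab)^\alpha$ is the image of the set $ab$; an isomorphism is a bijective homomorphism. $\mathbb{F}\simeq\mathbb{G}$ means that an isomorphism from $\mathbb{F}$ to $\mathbb{G}$ exists; $\simeq$ is an equivalence relation on the set of closed subsets of $\mathbb{H}$. $\binom{m}{r}_2$ is the Gauss coefficient: the number of subgroups of $2$-rank $r$ of an elementary abelian $2$-group of $2$-rank $m$. *)

theory Defs
  imports "HOL-Algebra.Elementary_Groups" "HOL-Algebra.Product_Groups"
begin

section \<open>Hypergroups\<close>

record 'a hyperstructure = "'a partial_object" +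
  hmult :: "'a \<Rightarrow> 'a \<Rightarrow> 'a set"
  star :: "'a \<Rightarrow> 'a"

definition hprod :: "('a, 'b) hyperstructure_scheme \<Rightarrow> 'a set \<Rightarrow> 'a set \<Rightarrow> 'a set" where
  "hprod H F G = (\<Union>b\<in>F. \<Union>c\<in>G. hmult H b c)"

definition is_neutral :: "('a, 'b) hyperstructure_scheme \<Rightarrow> 'a \<Rightarrow> bool" where
  "is_neutral H e \<longleftrightarrow>
     e \<in> carrier H \<and> (\<forall>a\<in>carrier H. hmult H e a = {a} \<and> hmult H a e = {a})"

locale hypergroup =
  fixes H :: "('a, 'b) hyperstructure_scheme"
  assumes nonempty: "carrier H \<noteq> {}"
    and hmult_closed: "\<lbrakk>a \<in> carrier H; b \<in> carrier H\<rbrakk> \<Longrightarrow> hmult H a b \<subseteq> carrier H"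
    and star_closed: "a \<in> carrier H \<Longrightarrow> star H a \<in> carrier H"
    and assoc: "\<lbrakk>a \<in> carrier H; b \<in> carrier H; c \<in> carrier H\<rbrakk> \<Longrightarrow>
      hprod H (hmult H a b) {c} = hprod H {a} (hmult H b c)"
    and neutral_ex1: "\<exists>!e. is_neutral H e"
    and exchange1: "\<lbrakk>a \<in> carrier H; b \<in> carrier H; c \<in> carrier H\<rbrakk> \<Longrightarrow>
      a \<in> hmult H b c \<longleftrightarrow> b \<in> hmult H a (star H c)"
    and exchange2: "\<lbrakk>a \<in> carrier H; b \<in> carrier H; c \<in> carrier H\<rbrakk> \<Longrightarrow>
      a \<in> hmult H b c \<longleftrightarrow> c \<in> hmult H (star H b) a"

definition neutral :: "('a, 'b) hyperstructure_scheme \<Rightarrow> 'a" where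
  "neutral H = (THE e. is_neutral H e)"

definition closed_subset :: "('a, 'b) hyperstructure_scheme \<Rightarrow> 'a set \<Rightarrow> bool" where
  "closed_subset H G \<longleftrightarrow> G \<noteq> {} \<and> G \<subseteq> carrier H \<and> hprod H (star H ` G) G \<subseteq> G"

definition closed_gen :: "('a, 'b) hyperstructure_scheme \<Rightarrow> 'a \<Rightarrow> 'a set" where
  "closed_gen H a = \<Inter>{G. closed_subset H G \<and> a \<in> G}"

definition thin :: "('a, 'b) hyperstructure_scheme \<Rightarrow> 'a \<Rightarrow> bool" where
  "thin H a \<longleftrightarrow> hmult H (star H a) a = {neutral H}"

abbreviation thick :: "('a, 'b) hyperstructure_scheme \<Rightarrow> 'a \<Rightarrow> bool" where
  "thick H a \<equiv> \<not> thin H a"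

definition thin_closed_subset :: "('a, 'b) hyperstructure_scheme \<Rightarrow> 'a set \<Rightarrow> bool" where
  "thin_closed_subset H G \<longleftrightarrow> closed_subset H G \<and> (\<forall>a\<in>G. thin H a)"

definition normal_closed_subset :: "('a, 'b) hyperstructure_scheme \<Rightarrow> 'a set \<Rightarrow> bool" where
  "normal_closed_subset H F \<longleftrightarrow>
     closed_subset H F \<and> (\<forall>a\<in>carrier H. hprod H F {a} = hprod H {a} F)"

definition involution :: "('a, 'b) hyperstructure_scheme \<Rightarrow> 'a \<Rightarrow> bool" where
  "involution H a \<longleftrightarrow> a \<in> carrier H \<and> a \<noteq> neutral H \<and> closed_subset H {neutral H, a}"


section \<open>The 2-rank\<close>

definition elementary_abelian_2_group :: "('a, 'b) monoid_scheme \<Rightarrow> bool" where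
  "elementary_abelian_2_group G \<longleftrightarrow>
     comm_group G \<and> (\<forall>x\<in>carrier G. x \<otimes>\<^bsub>G\<^esub> x = \<one>\<^bsub>G\<^esub>)"

text \<open>The 2-rank of a finite group: the largest rank of an elementary abelian 2-subgroup.\<close>

definition two_rank :: "('a, 'b) monoid_scheme \<Rightarrow> nat" where
  "two_rank G = Max {n. \<exists>K. subgroup K G \<and>
     elementary_abelian_2_group (G\<lparr>carrier := K\<rparr>) \<and> card K = 2 ^ n}"

text \<open>The group of singletons of a thin closed subset; there \<open>{a} \<bullet> {b} = ab\<close> is the
  complex product of \<open>{a}\<close> and \<open>{b}\<close>.\<close>

definition thin_group :: "('a, 'b) hyperstructure_scheme \<Rightarrow> 'a set \<Rightarrow> 'a set monoid" where
  "thin_group H G =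
     \<lparr>carrier = (\<lambda>a. {a}) ` G, monoid.mult = hprod H, one = {neutral H}\<rparr>"

definition r2 :: "('a, 'b) hyperstructure_scheme \<Rightarrow> 'a set \<Rightarrow> nat" where
  "r2 H G = Max {two_rank (thin_group H T) | T. thin_closed_subset H T \<and> T \<subseteq> G}"


section \<open>Direct products and elementary abelian 2-hypergroups\<close>

definition hprod_list :: "('a, 'b) hyperstructure_scheme \<Rightarrow> 'a set list \<Rightarrow> 'a set" where
  "hprod_list H As = foldr (hprod H) As {neutral H}"

text \<open>Families are indexed by \<open>1, \<dots>, p\<close>; values at other indices are irrelevant.\<close>

definition cofactor :: "('a, 'b) hyperstructure_scheme \<Rightarrow> nat \<Rightarrow> (nat \<Rightarrow> 'a set) \<Rightarrow> nat \<Rightarrow> 'a set"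
  where "cofactor H p G i = hprod_list H (map G [j \<leftarrow> [1..<Suc p]. j \<noteq> i])"

definition direct_product :: "('a, 'b) hyperstructure_scheme \<Rightarrow> nat \<Rightarrow> (nat \<Rightarrow> 'a set) \<Rightarrow> bool"
  where "direct_product H p G \<longleftrightarrow> p \<ge> 1 \<and>
     (\<forall>i\<in>{1..p}. normal_closed_subset H (G i) \<and>
        carrier H = hprod H (G i) (cofactor H p G i) \<and>
        G i \<inter> cofactor H p G i = {neutral H})"

text \<open>The product \<open>r\<^sub>1 r\<^sub>2 \<dots> r\<^sub>p\<close>.\<close>

definition elem_prod :: "('a, 'b) hyperstructure_scheme \<Rightarrow> nat \<Rightarrow> (nat \<Rightarrow> 'a) \<Rightarrow> 'a set" where
  "elem_prod H p r = hprod_list H (map (\<lambda>i. {r i}) [1..<Suc p])"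

text \<open>In a direct product each element \<open>a\<close> lies in \<open>r\<^sub>1 r\<^sub>2 \<dots> r\<^sub>p\<close> for unique
  \<open>r\<^sub>i \<in> G\<^sub>i\<close>. The extensional function space makes \<open>r\<close> itself unique.\<close>

definition components ::
    "('a, 'b) hyperstructure_scheme \<Rightarrow> nat \<Rightarrow> (nat \<Rightarrow> 'a set) \<Rightarrow> 'a \<Rightarrow> nat \<Rightarrow> 'a" where
  "components H p G a = (THE r. r \<in> (\<Pi>\<^sub>E i\<in>{1..p}. G i) \<and> a \<in> elem_prod H p r)"

definition support ::
    "('a, 'b) hyperstructure_scheme \<Rightarrow> nat \<Rightarrow> (nat \<Rightarrow> 'a set) \<Rightarrow> 'a \<Rightarrow> 'a set" where
  "support H p G a = components H p G a ` {1..p} - {neutral H}"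

definition constrained_direct_product ::
    "('a, 'b) hyperstructure_scheme \<Rightarrow> nat \<Rightarrow> (nat \<Rightarrow> 'a set) \<Rightarrow> bool" where
  "constrained_direct_product H p G \<longleftrightarrow> direct_product H p G \<and>
     (\<forall>a\<in>carrier H. elem_prod H p (components H p G a) = {a})"

definition elementary_abelian_2_hypergroup ::
    "('a, 'b) hyperstructure_scheme \<Rightarrow> nat \<Rightarrow> (nat \<Rightarrow> 'a) \<Rightarrow> bool" where
  "elementary_abelian_2_hypergroup H p q \<longleftrightarrow> hypergroup H \<and>
     (\<forall>i\<in>{1..p}. involution H (q i)) \<and>
     constrained_direct_product H p (\<lambda>i. closed_gen H (q i))"

text \<open>The number called \<open>p\<^sup>\<sharp>\<close>.\<close>

definition p_sharp :: "('a, 'b) hyperstructure_scheme \<Rightarrow> nat \<Rightarrow> (nat \<Rightarrow> 'a) \<Rightarrow> nat" where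
  "p_sharp H p q = card {a \<in> q ` {1..p}. thick H a}"

definition s_elem ::
    "('a, 'b) hyperstructure_scheme \<Rightarrow> nat \<Rightarrow> (nat \<Rightarrow> 'a) \<Rightarrow> 'a \<Rightarrow> nat" where
  "s_elem H p q a = card {b \<in> support H p (\<lambda>i. closed_gen H (q i)) a. thick H b}"

definition s_set ::
    "('a, 'b) hyperstructure_scheme \<Rightarrow> nat \<Rightarrow> (nat \<Rightarrow> 'a) \<Rightarrow> 'a set \<Rightarrow> nat" where
  "s_set H p q G = Max (s_elem H p q ` G)"


section \<open>Isomorphism of closed subsets\<close>

definition hyper_hom :: "('a, 'b) hyperstructure_scheme \<Rightarrow> 'a set \<Rightarrow> 'a set \<Rightarrow> ('a \<Rightarrow> 'a) set" where
  "hyper_hom H F G = {\<alpha>. \<alpha> ` F \<subseteq> G \<and> \<alpha> (neutral H) = neutral H \<and>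
     (\<forall>a\<in>F. \<forall>b\<in>F. \<alpha> ` hmult H a b = hmult H (\<alpha> a) (\<alpha> b))}"

definition hyper_iso :: "('a, 'b) hyperstructure_scheme \<Rightarrow> 'a set \<Rightarrow> 'a set \<Rightarrow> bool" where
  "hyper_iso H F G \<longleftrightarrow> (\<exists>\<alpha>\<in>hyper_hom H F G. bij_betw \<alpha> F G)"

definition closed_subsets :: "('a, 'b) hyperstructure_scheme \<Rightarrow> 'a set set" where
  "closed_subsets H = {G. closed_subset H G}"

definition iso_rel :: "('a, 'b) hyperstructure_scheme \<Rightarrow> ('a set \<times> 'a set) set" where
  "iso_rel H = {(F, G). F \<in> closed_subsets H \<and> G \<in> closed_subsets H \<and> hyper_iso H F G}"


section \<open>The Gauss coefficient at 2\<close>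

definition std_elementary_abelian_2_group :: "nat \<Rightarrow> (nat \<Rightarrow> int) monoid" where
  "std_elementary_abelian_2_group m = product_group {..<m} (\<lambda>_. integer_mod_group 2)"

lemma elementary_abelian_2_group_std:
  "elementary_abelian_2_group (std_elementary_abelian_2_group m)"
proof -
  let ?E = "std_elementary_abelian_2_group m"
  interpret group ?E
    by (simp add: std_elementary_abelian_2_group_def)
  have "x \<otimes>\<^bsub>?E\<^esub> x = \<one>\<^bsub>?E\<^esub>" if "x \<in> carrier ?E" for x
    using that by (auto simp: std_elementary_abelian_2_group_def fun_eq_iff)
  moreover have "comm_group ?E"
    by unfold_locales
      (auto simp: std_elementary_abelian_2_group_def fun_eq_iff add.commute)
  ultimately show ?thesis
    by (simp add: elementary_abelian_2_group_def)
qed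

lemma card_std_elementary_abelian_2_group:
  "card (carrier (std_elementary_abelian_2_group m)) = 2 ^ m"
  by (simp add: std_elementary_abelian_2_group_def carrier_integer_mod_group card_PiE)

lemma two_rank_std_elementary_abelian_2_group:
  "two_rank (std_elementary_abelian_2_group m) = m"
proof -
  let ?E = "std_elementary_abelian_2_group m"
  let ?R = "{n. \<exists>K. subgroup K ?E \<and>
     elementary_abelian_2_group (?E\<lparr>carrier := K\<rparr>) \<and> card K = 2 ^ n}"
  interpret group ?E
    by (simp add: std_elementary_abelian_2_group_def)
  have fin: "finite (carrier ?E)"
    by (rule card_ge_0_finite) (simp add: card_std_elementary_abelian_2_group)
  have le: "n \<le> m" if n: "n \<in> ?R" for n
  proof -
    obtain K where "subgroup K ?E" "card K = 2 ^ n"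
      using n by blast
    then have "(2::nat) ^ n \<le> 2 ^ m"
      by (metis card_mono card_std_elementary_abelian_2_group fin subgroup.subset)
    then show ?thesis
      by simp
  qed
  have "m \<in> ?R"
    using subgroup_self elementary_abelian_2_group_std card_std_elementary_abelian_2_group
    by auto
  moreover have "finite ?R"
    using le by (meson finite_nat_set_iff_bounded_le)
  ultimately show ?thesis
    unfolding two_rank_def using le by (intro Max_eqI) auto
qed

definition gauss_coeff :: "nat \<Rightarrow> nat \<Rightarrow> nat" where
  "gauss_coeff m r =
     (let E = std_elementary_abelian_2_group m
      in card {K. subgroup K E \<and> two_rank (E\<lparr>carrier := K\<rparr>) = r})"

end

theory Submission
  imports Defs
begin

text \<open>
  Encode the element with support \<open>{q\<^sub>i : i \<in> A}\<close> by the index set \<open>A\<close>, and let \<open>T\<close> be the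
  set of indices of thick involutions. As involutions commute, a product is computed index by
  index, so the product of \<open>A\<close> and \<open>B\<close> consists of all sets between the symmetric difference
  \<open>D\<close> of \<open>A\<close> and \<open>B\<close> and \<open>D \<union> (A \<inter> B \<inter> T)\<close>. A closed subset therefore splits into a thick
  and a thin part: it consists of the sets \<open>B \<union> V\<close> with \<open>B \<subseteq> S\<close> and \<open>V \<in> W\<close>, for a unique
  \<open>S \<subseteq> T\<close> and a unique family \<open>W\<close> of subsets of the complement of \<open>T\<close> that is an \<open>\<bbbF>\<^sub>2\<close>-space
  under symmetric difference. Its invariants are \<open>s = |S|\<close> and \<open>r\<^sub>2 = r\<close> with \<open>r = dim W\<close>, and
  its cardinality is \<open>2\<^bsup>s + r\<^esup>\<close>.
  An isomorphism preserves cardinality and thinness, hence \<open>s\<close> and \<open>r\<^sub>2\<close>; conversely a bijection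
  of the thick parts and a linear isomorphism of the thin parts combine to an isomorphism.
\<close>

section \<open>Products of subsets of a hypergroup\<close>

lemma mem_hprod: "a \<in> hprod H F G \<longleftrightarrow> (\<exists>b\<in>F. \<exists>c\<in>G. a \<in> hmult H b c)"
  by (auto simp: hprod_def)

lemma hprod_mono: "F \<subseteq> F' \<Longrightarrow> G \<subseteq> G' \<Longrightarrow> hprod H F G \<subseteq> hprod H F' G'"
  by (force simp: hprod_def)

lemma hprod_singletons [simp]: "hprod H {a} {b} = hmult H a b"
  by (simp add: hprod_def)

context hypergroup
begin

abbreviation e where "e \<equiv> neutral H"

abbreviation set_prod (infixl "\<odot>" 70) where "F \<odot> G \<equiv> hprod H F G"

lemma is_neutral_neutral: "is_neutral H e"
  unfolding neutral_def using neutral_ex1 by (rule theI')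

lemma neutral_in [simp]: "e \<in> carrier H"
  using is_neutral_neutral by (simp add: is_neutral_def)

lemma hmult_neutral [simp]:
  assumes "a \<in> carrier H"
  shows "hmult H e a = {a}" "hmult H a e = {a}"
  using is_neutral_neutral assms by (auto simp: is_neutral_def)

lemma set_prod_closed [simp]:
  "F \<subseteq> carrier H \<Longrightarrow> G \<subseteq> carrier H \<Longrightarrow> F \<odot> G \<subseteq> carrier H"
  unfolding hprod_def by (intro UN_least hmult_closed) auto

lemma set_prod_neutral [simp]:
  assumes "F \<subseteq> carrier H"
  shows "{e} \<odot> F = F" "F \<odot> {e} = F"
proof -
  have "{e} \<odot> F = (\<Union>a\<in>F. {a})" "F \<odot> {e} = (\<Union>a\<in>F. {a})"
    unfolding hprod_def using assms by (auto simp: subset_iff)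
  then show "{e} \<odot> F = F" "F \<odot> {e} = F"
    by simp_all
qed

lemma set_prod_assoc:
  assumes "F \<subseteq> carrier H" "G \<subseteq> carrier H" "K \<subseteq> carrier H"
  shows "F \<odot> G \<odot> K = F \<odot> (G \<odot> K)"
proof -
  have "F \<odot> G \<odot> K = (\<Union>a\<in>F. \<Union>b\<in>G. \<Union>c\<in>K. hmult H a b \<odot> {c})"
    by (auto simp: hprod_def)
  also have "\<dots> = (\<Union>a\<in>F. \<Union>b\<in>G. \<Union>c\<in>K. {a} \<odot> hmult H b c)"
    using assms by (intro SUP_cong refl assoc) auto
  also have "\<dots> = F \<odot> (G \<odot> K)"
    by (auto simp: hprod_def)
  finally show ?thesis .
qed

section \<open>The star map and nonempty products\<close>

lemma neutral_in_star_hmult: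
  assumes "a \<in> carrier H"
  shows "e \<in> hmult H (star H a) a"
  using exchange2[of a a e] assms by simp

lemma star_neutral [simp]: "star H e = e"
  using neutral_in_star_hmult[of e] star_closed[of e] by simp

text \<open>Since \<open>e\<close> lies in the product of \<open>star H a\<close> and
  \<open>a\<close>, associativity would place \<open>b\<close> in the product of
  \<open>star H a\<close> with the empty set.\<close>

lemma hmult_nonempty:
  assumes "a \<in> carrier H" "b \<in> carrier H"
  shows "hmult H a b \<noteq> {}"
proof
  assume "hmult H a b = {}"
  then have "hmult H (star H a) a \<odot> {b} = {}"
    using assoc[of "star H a" a b] assms star_closed by (auto simp: hprod_def)
  moreover have "b \<in> hmult H (star H a) a \<odot> {b}"
    using neutral_in_star_hmult[OF assms(1)] assms by (force simp: mem_hprod)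
  ultimately show False
    by blast
qed

lemma set_prod_nonempty:
  assumes "F \<subseteq> carrier H" "G \<subseteq> carrier H" "F \<noteq> {}" "G \<noteq> {}"
  shows "F \<odot> G \<noteq> {}"
proof -
  obtain b c where "b \<in> F" "c \<in> G"
    using assms by blast
  moreover from this obtain a where "a \<in> hmult H b c"
    using assms hmult_nonempty[of b c] by blast
  ultimately show ?thesis
    unfolding ex_in_conv[symmetric] mem_hprod by blast
qed

text \<open>Three exchanges, writing c' for \<open>star H c\<close>: from c in ab follow b in a'c,
  then a' in bc', then c' in b'a'.\<close>

lemma star_mem_hmult:
  assumes "a \<in> carrier H" "b \<in> carrier H" "c \<in> hmult H a b"
  shows "star H c \<in> hmult H (star H b) (star H a)"
proof -
  have c: "c \<in> carrier H"
    using hmult_closed assms by blast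
  have "b \<in> hmult H (star H a) c"
    using exchange2 assms c by blast
  then have "star H a \<in> hmult H b (star H c)"
    using exchange1 assms c star_closed by blast
  then show ?thesis
    using exchange2 assms c star_closed by blast
qed

section \<open>Closed subsets\<close>

lemma closed_subset_neutral:
  assumes "closed_subset H G"
  shows "e \<in> G"
proof -
  obtain a where a: "a \<in> G" "a \<in> carrier H"
    using assms by (auto simp: closed_subset_def)
  then have "e \<in> star H ` G \<odot> G"
    using neutral_in_star_hmult unfolding mem_hprod by blast
  then show ?thesis
    using assms by (auto simp: closed_subset_def)
qed

lemma closed_subset_carrier: "closed_subset H G \<Longrightarrow> G \<subseteq> carrier H"
  by (simp add: closed_subset_def)

lemma closed_subset_star:
  assumes "closed_subset H G" "a \<in> G"
  shows "star H a \<in> G"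
proof -
  have "star H a \<in> hmult H (star H a) e"
    using assms star_closed[of a] closed_subset_carrier[of G] by auto
  then show ?thesis
    using assms closed_subset_neutral[OF assms(1)] unfolding closed_subset_def hprod_def by blast
qed

text \<open>An exchange applied to \<open>e\<close> in the product of \<open>star H a\<close> and
  \<open>a\<close> puts \<open>a\<close> into the product of \<open>star H (star H a)\<close> and
  \<open>e\<close>, which is a singleton.\<close>

lemma star_star:
  assumes "a \<in> carrier H"
  shows "star H (star H a) = a"
proof -
  have "a \<in> hmult H (star H (star H a)) e"
    using exchange2[of e "star H a" a] assms star_closed neutral_in_star_hmult by auto
  then show ?thesis
    using assms star_closed by simp
qed

text \<open>The definition of a closed subset only controls products with a starred left factor. It
  is applied to \<open>star H a\<close>, whose star is \<open>a\<close> again.\<close>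

lemma closed_subset_hmult:
  assumes "closed_subset H G" "a \<in> G" "b \<in> G"
  shows "hmult H a b \<subseteq> G"
proof -
  have "hmult H (star H (star H a)) b \<subseteq> G"
    using assms closed_subset_star[OF assms(1,2)] unfolding closed_subset_def hprod_def by blast
  then show ?thesis
    using star_star[of a] subsetD[OF closed_subset_carrier[OF assms(1)] assms(2)] by simp
qed

lemma closed_subsetI:
  assumes "G \<subseteq> carrier H" "e \<in> G" "\<And>a. a \<in> G \<Longrightarrow> star H a \<in> G"
    and "\<And>a b. a \<in> G \<Longrightarrow> b \<in> G \<Longrightarrow> hmult H a b \<subseteq> G"
  shows "closed_subset H G"
proof -
  have "star H ` G \<odot> G \<subseteq> G"
    unfolding hprod_def by (intro UN_least assms(4)) (auto intro: assms(3))
  then show ?thesis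
    using assms(1,2) by (auto simp: closed_subset_def)
qed

lemma closed_gen_eq:
  assumes "involution H a"
  shows "closed_gen H a = {e, a}"
proof -
  have "{e, a} \<subseteq> G" if "closed_subset H G" "a \<in> G" for G
    using closed_subset_neutral that by blast
  moreover have "closed_subset H {e, a}"
    using assms by (simp add: involution_def)
  ultimately show ?thesis
    unfolding closed_gen_def by (intro equalityI Inter_lower Inter_greatest) auto
qed

section \<open>Normal closed subsets\<close>

lemma normal_commute:
  assumes "normal_closed_subset H F" "X \<subseteq> carrier H"
  shows "F \<odot> X = X \<odot> F"
proof -
  have "F \<odot> X = (\<Union>a\<in>X. F \<odot> {a})" "X \<odot> F = (\<Union>a\<in>X. {a} \<odot> F)"
    by (auto simp: hprod_def)
  then show ?thesis
    using assms unfolding normal_closed_subset_def by (metis (no_types, lifting) SUP_cong subsetD)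
qed

lemma normal_closed_neutral: "normal_closed_subset H {e}"
proof -
  have "closed_subset H {e}"
    by (rule closed_subsetI) auto
  then show ?thesis
    by (auto simp: normal_closed_subset_def)
qed

text \<open>As \<open>F\<close> and \<open>G\<close> commute, the square of FG is FFGG, hence inside
  FG, and \<open>star H\<close> maps FG into GF = FG. By induction the cofactors of a direct product
  are normal closed subsets too.\<close>

lemma normal_closed_set_prod:
  assumes F: "normal_closed_subset H F" and G: "normal_closed_subset H G"
  shows "normal_closed_subset H (F \<odot> G)"
proof -
  have cl: "closed_subset H F" "closed_subset H G"
    and sub [simp]: "F \<subseteq> carrier H" "G \<subseteq> carrier H"
    using F G closed_subset_carrier unfolding normal_closed_subset_def by auto
  have idem: "F \<odot> F \<subseteq> F" "G \<odot> G \<subseteq> G"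
    using cl closed_subset_hmult unfolding hprod_def by blast+
  have "F \<odot> G \<odot> (F \<odot> G) = F \<odot> (G \<odot> F \<odot> G)"
    by (simp add: set_prod_assoc)
  also have "\<dots> = F \<odot> (F \<odot> G \<odot> G)"
    using normal_commute[OF F] by simp
  also have "\<dots> = F \<odot> F \<odot> (G \<odot> G)"
    by (simp add: set_prod_assoc)
  also have "\<dots> \<subseteq> F \<odot> G"
    using idem by (rule hprod_mono)
  finally have mult: "F \<odot> G \<odot> (F \<odot> G) \<subseteq> F \<odot> G" .
  have "closed_subset H (F \<odot> G)"
  proof (rule closed_subsetI)
    show "e \<in> F \<odot> G"
      using closed_subset_neutral[OF cl(1)] closed_subset_neutral[OF cl(2)]
        hmult_neutral(1)[OF neutral_in] unfolding mem_hprod by blast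
    show "star H a \<in> F \<odot> G" if a: "a \<in> F \<odot> G" for a
    proof -
      obtain b c where "b \<in> F" "c \<in> G" "a \<in> hmult H b c"
        using a by (auto simp: mem_hprod)
      then have "star H c \<in> G" "star H b \<in> F" "star H a \<in> hmult H (star H c) (star H b)"
        using star_mem_hmult[of b c a] cl[THEN closed_subset_star] subsetD[OF sub(1)] subsetD[OF sub(2)]
        by blast+
      then have "star H a \<in> G \<odot> F"
        by (auto simp: mem_hprod)
      then show ?thesis
        using normal_commute[OF F sub(2)] by simp
    qed
    show "hmult H a b \<subseteq> F \<odot> G" if "a \<in> F \<odot> G" "b \<in> F \<odot> G" for a b
    proof -
      have "{a} \<odot> {b} \<subseteq> F \<odot> G \<odot> (F \<odot> G)"
        using that by (intro hprod_mono) auto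
      then show ?thesis
        using mult by simp
    qed
  qed simp
  moreover have "F \<odot> G \<odot> {a} = {a} \<odot> (F \<odot> G)" if a: "a \<in> carrier H" for a
  proof -
    have "F \<odot> G \<odot> {a} = F \<odot> ({a} \<odot> G)"
      using a normal_commute[OF G, of "{a}"] by (simp add: set_prod_assoc)
    also have "\<dots> = {a} \<odot> F \<odot> G"
      using a normal_commute[OF F, of "{a}"] by (simp flip: set_prod_assoc)
    finally show ?thesis
      using a by (simp add: set_prod_assoc)
  qed
  ultimately show ?thesis
    by (simp add: normal_closed_subset_def)
qed

section \<open>Products of lists of subsets\<close>

lemma hprod_list_Nil [simp]: "hprod_list H [] = {e}"
  by (simp add: hprod_list_def)

lemma hprod_list_Cons [simp]: "hprod_list H (F # Fs) = F \<odot> hprod_list H Fs"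
  by (simp add: hprod_list_def)

lemma hprod_list_closed:
  "\<forall>F\<in>set Fs. F \<subseteq> carrier H \<Longrightarrow> hprod_list H Fs \<subseteq> carrier H"
  by (induction Fs) simp_all

lemma hprod_list_map_closed:
  "(\<And>i. i \<in> set js \<Longrightarrow> F i \<subseteq> carrier H) \<Longrightarrow> hprod_list H (map F js) \<subseteq> carrier H"
  by (rule hprod_list_closed) (simp only: set_map ball_simps, blast)

lemma hprod_list_append:
  assumes "\<forall>F\<in>set Fs. F \<subseteq> carrier H" "\<forall>G\<in>set Gs. G \<subseteq> carrier H"
  shows "hprod_list H (Fs @ Gs) = hprod_list H Fs \<odot> hprod_list H Gs"
  using assms(1)
proof (induction Fs)
  case Nil
  then show ?case
    using assms(2) by (simp add: hprod_list_closed)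
next
  case (Cons F Fs)
  have "F \<subseteq> carrier H" "hprod_list H Fs \<subseteq> carrier H" "hprod_list H Gs \<subseteq> carrier H"
    using Cons.prems assms(2) by (simp_all add: hprod_list_closed)
  with Cons show ?case
    by (simp add: set_prod_assoc)
qed

lemma normal_closed_hprod_list:
  "\<forall>F\<in>set Fs. normal_closed_subset H F \<Longrightarrow> normal_closed_subset H (hprod_list H Fs)"
  by (induction Fs) (simp_all add: normal_closed_neutral normal_closed_set_prod)

lemma hprod_list_mono:
  "\<forall>i\<in>set js. F i \<subseteq> G i \<Longrightarrow> hprod_list H (map F js) \<subseteq> hprod_list H (map G js)"
proof (induction js)
  case (Cons j js)
  then show ?case
    by (simp add: hprod_mono)
qed simp

lemma hprod_list_nonempty:
  "\<forall>F\<in>set Fs. F \<subseteq> carrier H \<and> F \<noteq> {} \<Longrightarrow> hprod_list H Fs \<noteq> {}"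
proof (induction Fs)
  case (Cons F Fs)
  then have "hprod_list H Fs \<subseteq> carrier H"
    by (intro hprod_list_closed) simp
  moreover have "hprod_list H Fs \<noteq> {}" "F \<subseteq> carrier H" "F \<noteq> {}"
    using Cons by simp_all
  ultimately show ?case
    unfolding hprod_list_Cons by (intro set_prod_nonempty)
qed simp

lemma commute_hprod_list:
  assumes X: "X \<subseteq> carrier H" and "\<And>i. i \<in> set js \<Longrightarrow> F i \<subseteq> carrier H"
    and "\<And>i. i \<in> set js \<Longrightarrow> X \<odot> F i = F i \<odot> X"
  shows "X \<odot> hprod_list H (map F js) = hprod_list H (map F js) \<odot> X"
  using assms(2,3)
proof (induction js)
  case (Cons j js)
  have sub: "F j \<subseteq> carrier H" "hprod_list H (map F js) \<subseteq> carrier H"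
    by (intro hprod_list_map_closed Cons.prems(1) list.set_intros; assumption)+
  have "X \<odot> F j = F j \<odot> X"
    by (rule Cons.prems(2)) simp
  then have "X \<odot> (F j \<odot> hprod_list H (map F js)) = F j \<odot> (X \<odot> hprod_list H (map F js))"
    using X sub by (metis set_prod_assoc)
  also have "X \<odot> hprod_list H (map F js) = hprod_list H (map F js) \<odot> X"
    by (intro Cons.IH Cons.prems list.set_intros; assumption)
  finally show ?case
    using X sub by (simp add: set_prod_assoc)
qed (use X in simp)

text \<open>Factors with different indices commute, so the two products can be interleaved. Applied
  to singletons, this is what allows elements to be multiplied index by index.\<close>

lemma hprod_list_mult:
  assumes "distinct js" "\<And>i. i \<in> set js \<Longrightarrow> F i \<subseteq> carrier H"
    "\<And>i. i \<in> set js \<Longrightarrow> G i \<subseteq> carrier H"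
    and "\<And>i j. i \<in> set js \<Longrightarrow> j \<in> set js \<Longrightarrow> i \<noteq> j \<Longrightarrow> G i \<odot> F j = F j \<odot> G i"
  shows "hprod_list H (map F js) \<odot> hprod_list H (map G js)
    = hprod_list H (map (\<lambda>i. F i \<odot> G i) js)"
  using assms
proof (induction js)
  case (Cons j js)
  let ?F = "hprod_list H (map F js)" and ?G = "hprod_list H (map G js)"
  have [simp]: "F j \<subseteq> carrier H" "G j \<subseteq> carrier H" "?F \<subseteq> carrier H" "?G \<subseteq> carrier H"
    by (intro hprod_list_map_closed Cons.prems(2,3) list.set_intros; assumption)+
  have comm: "G j \<odot> ?F = ?F \<odot> G j"
  proof (rule commute_hprod_list)
    fix i assume i: "i \<in> set js"
    then show "F i \<subseteq> carrier H"
      by (intro Cons.prems list.set_intros)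
    show "G j \<odot> F i = F i \<odot> G j"
      using i Cons.prems(1) by (intro Cons.prems(4)) auto
  qed simp
  have "F j \<odot> ?F \<odot> (G j \<odot> ?G) = F j \<odot> (?F \<odot> G j) \<odot> ?G"
    by (simp add: set_prod_assoc)
  also have "\<dots> = F j \<odot> G j \<odot> (?F \<odot> ?G)"
    unfolding comm[symmetric] by (simp add: set_prod_assoc)
  also have "?F \<odot> ?G = hprod_list H (map (\<lambda>i. F i \<odot> G i) js)"
    using Cons by (metis distinct.simps(2) list.set_intros(2))
  finally show ?case
    by simp
qed simp

text \<open>Unfolding the product one factor at a time yields one chosen member per factor. Distinct
  indices allow these choices to be combined in a single function \<open>r\<close>.\<close>

lemma mem_hprod_list:
  assumes "distinct js"
  shows "a \<in> hprod_list H (map F js) \<longleftrightarrow>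
    (\<exists>r. (\<forall>i\<in>set js. r i \<in> F i) \<and> a \<in> hprod_list H (map (\<lambda>i. {r i}) js))"
  using assms
proof (induction js arbitrary: a)
  case (Cons j js)
  show ?case (is "?l \<longleftrightarrow> ?r")
  proof
    assume ?l
    then obtain b c where b: "b \<in> F j" and c: "c \<in> hprod_list H (map F js)" and a: "a \<in> hmult H b c"
      by (auto simp: mem_hprod)
    from c obtain r where r: "\<forall>i\<in>set js. r i \<in> F i" "c \<in> hprod_list H (map (\<lambda>i. {r i}) js)"
      using Cons by auto
    have eq: "map (\<lambda>i. {(r(j := b)) i}) js = map (\<lambda>i. {r i}) js"
      using Cons.prems by auto
    have "a \<in> hprod_list H (map (\<lambda>i. {(r(j := b)) i}) (j # js))"
      unfolding list.map hprod_list_Cons eq mem_hprod using a r(2) by auto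
    with b r(1) show ?r
      using Cons.prems by (intro exI[of _ "r(j := b)"]) auto
  next
    assume ?r
    then obtain r where r: "\<forall>i\<in>set (j # js). r i \<in> F i"
        "a \<in> hprod_list H (map (\<lambda>i. {r i}) (j # js))"
      by blast
    have "hprod_list H (map (\<lambda>i. {r i}) (j # js)) \<subseteq> hprod_list H (map F (j # js))"
      using r(1) by (intro hprod_list_mono) blast
    then show ?l
      using r(2) by blast
  qed
qed simp

end

section \<open>Families of sets closed under symmetric difference\<close>

text \<open>The subspaces of the power set of \<open>N\<close>, viewed as a vector space over the
  field with two elements, where closure under scalars only requires the zero vector
  \<open>{}\<close>.\<close>

definition xor_space :: "'i set \<Rightarrow> 'i set set \<Rightarrow> bool" where
  "xor_space N W \<longleftrightarrow> W \<subseteq> Pow N \<and> {} \<in> W \<and> (\<forall>U\<in>W. \<forall>V\<in>W. sym_diff U V \<in> W)"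

text \<open>Over the field with two elements, additivity already is linearity.\<close>

definition xor_hom_on :: "'i set set \<Rightarrow> ('i set \<Rightarrow> 'j set) \<Rightarrow> bool" where
  "xor_hom_on D f \<longleftrightarrow> (\<forall>A\<in>D. \<forall>B\<in>D. f (sym_diff A B) = sym_diff (f A) (f B))"

lemma xor_space_Pow: "M \<subseteq> N \<Longrightarrow> xor_space N (Pow M)"
  unfolding xor_space_def by blast

lemma xor_space_subset: "xor_space N W \<Longrightarrow> W \<subseteq> Pow N"
  and xor_space_empty: "xor_space N W \<Longrightarrow> {} \<in> W"
  and xor_space_sym_diff: "xor_space N W \<Longrightarrow> U \<in> W \<Longrightarrow> V \<in> W \<Longrightarrow> sym_diff U V \<in> W"
  by (simp_all add: xor_space_def)

lemma finite_xor_space: "finite N \<Longrightarrow> xor_space N W \<Longrightarrow> finite W"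
  using xor_space_subset finite_subset by blast

lemma xor_hom_onD: "xor_hom_on D f \<Longrightarrow> A \<in> D \<Longrightarrow> B \<in> D \<Longrightarrow> f (sym_diff A B) = sym_diff (f A) (f B)"
  by (simp add: xor_hom_on_def)

lemma xor_hom_on_empty: "xor_hom_on D f \<Longrightarrow> {} \<in> D \<Longrightarrow> f {} = {}"
  using xor_hom_onD[of D f "{}" "{}"] by simp

text \<open>Adjoins \<open>w\<close> as the image of \<open>{k}\<close>, so a maximal injective \<open>f\<close> is onto \<open>W\<close>.\<close>

lemma xor_hom_extend:
  fixes f :: "nat set \<Rightarrow> 'j set"
  assumes f: "inj_on f (Pow {..<k})" "f ` Pow {..<k} \<subseteq> W" "xor_hom_on (Pow {..<k}) f"
    and W: "xor_space N W" and w: "w \<in> W" "w \<notin> f ` Pow {..<k}"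
  shows "\<exists>g. inj_on g (Pow {..<Suc k}) \<and> g ` Pow {..<Suc k} \<subseteq> W \<and> xor_hom_on (Pow {..<Suc k}) g"
proof -
  define c where "c A = (if k \<in> A then w else {})" for A
  define g where "g A = sym_diff (f (A - {k})) (c A)" for A
  have sub: "A - {k} \<in> Pow {..<k}" if "A \<in> Pow {..<Suc k}" for A
    using that by (auto simp: less_Suc_eq)
  have c_W: "c A \<in> W" for A
    using w(1) xor_space_empty[OF W] by (simp add: c_def)
  have c_sym: "c (sym_diff A B) = sym_diff (c A) (c B)" for A B
    by (simp add: c_def)
  have hom: "g (sym_diff A B) = sym_diff (g A) (g B)"
    if "A \<in> Pow {..<Suc k}" "B \<in> Pow {..<Suc k}" for A B
  proof -
    have "sym_diff A B - {k} = sym_diff (A - {k}) (B - {k})"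
      by blast
    then have "f (sym_diff A B - {k}) = sym_diff (f (A - {k})) (f (B - {k}))"
      using xor_hom_onD[OF f(3) sub[OF that(1)] sub[OF that(2)]] by simp
    then show ?thesis
      unfolding g_def c_sym by blast
  qed
  \<comment> \<open>Additivity reduces injectivity of \<open>g\<close> to a trivial kernel. A kernel
    member containing \<open>k\<close> would make \<open>w\<close> a value of
    \<open>f\<close>.\<close>
  have ker: "C = {}" if C: "C \<in> Pow {..<Suc k}" and "g C = {}" for C
  proof -
    have eq: "f (C - {k}) = c C"
      using that(2) unfolding g_def by blast
    have "k \<notin> C"
    proof
      assume "k \<in> C"
      then have "f (C - {k}) = w"
        using eq by (simp add: c_def)
      then show False
        using w(2) sub[OF C] by blast
    qed
    then have "f (C - {k}) = f {}"
      using eq xor_hom_on_empty[OF f(3)] by (simp add: c_def)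
    then show ?thesis
      using inj_onD[OF f(1), of "C - {k}" "{}"] sub[OF C] \<open>k \<notin> C\<close> by simp
  qed
  have "inj_on g (Pow {..<Suc k})"
  proof (rule inj_onI)
    fix A B assume AB: "A \<in> Pow {..<Suc k}" "B \<in> Pow {..<Suc k}" "g A = g B"
    then have "sym_diff A B = {}"
      using hom[OF AB(1,2)] by (intro ker) auto
    then show "A = B"
      by blast
  qed
  moreover have "g ` Pow {..<Suc k} \<subseteq> W"
  proof (rule image_subsetI)
    fix A assume "A \<in> Pow {..<Suc k}"
    then have "f (A - {k}) \<in> W"
      using f(2) sub by blast
    then show "g A \<in> W"
      unfolding g_def using xor_space_sym_diff[OF W] c_W by blast
  qed
  moreover have "xor_hom_on (Pow {..<Suc k}) g"
    unfolding xor_hom_on_def by (intro ballI hom)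
  ultimately show ?thesis
    by blast
qed

text \<open>This is the choice of a basis. Among the injective homomorphisms from some
  \<open>Pow {..<k}\<close> into \<open>W\<close>, one with the largest \<open>k\<close> must be
  onto, since a missed vector could be adjoined.\<close>

lemma xor_space_coordinates:
  assumes N: "finite N" and W: "xor_space N W"
  shows "\<exists>n f. bij_betw f (Pow {..<n::nat}) W \<and> xor_hom_on (Pow {..<n}) f"
proof -
  define P where "P k \<longleftrightarrow>
    (\<exists>f. inj_on f (Pow {..<k::nat}) \<and> f ` Pow {..<k} \<subseteq> W \<and> xor_hom_on (Pow {..<k}) f)" for k
  have finW: "finite W"
    using finite_xor_space[OF N W] .
  \<comment> \<open>A largest \<open>k\<close> exists because
    \<open>k < 2 ^ k \<le> card W\<close>.\<close>
  have bound: "k \<le> card W" if k: "P k" for k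
  proof -
    obtain f where "inj_on f (Pow {..<k})" "f ` Pow {..<k} \<subseteq> W"
      using k unfolding P_def by blast
    then have "card (Pow {..<k}) \<le> card W"
      using finW by (rule card_inj_on_le)
    then have "2 ^ k \<le> card W"
      by (simp add: card_Pow)
    then show ?thesis
      by (rule order.trans[OF less_imp_le[OF less_exp]])
  qed
  have "P 0"
    unfolding P_def using xor_space_empty[OF W]
    by (intro exI[of _ "\<lambda>_. {}"]) (simp add: xor_hom_on_def)
  define n where "n = Max {k. P k}"
  have "finite {k. P k}"
    using bound by (meson finite_nat_set_iff_bounded_le mem_Collect_eq)
  then have n: "P n" "\<And>k. P k \<Longrightarrow> k \<le> n"
    using \<open>P 0\<close> Max_in[of "{k. P k}"] by (auto simp: n_def)
  then obtain f where f: "inj_on f (Pow {..<n})" "f ` Pow {..<n} \<subseteq> W" "xor_hom_on (Pow {..<n}) f"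
    unfolding P_def by blast
  have "W \<subseteq> f ` Pow {..<n}"
  proof
    fix w assume "w \<in> W"
    show "w \<in> f ` Pow {..<n}"
    proof (rule ccontr)
      assume "w \<notin> f ` Pow {..<n}"
      then have "P (Suc n)"
        unfolding P_def using xor_hom_extend[OF f W \<open>w \<in> W\<close>] by blast
      then show False
        using n(2) by fastforce
    qed
  qed
  then show ?thesis
    using f by (auto simp: bij_betw_def)
qed

lemma card_xor_space:
  assumes "finite N" "xor_space N W"
  obtains n where "card W = 2 ^ n"
proof -
  obtain n f where "bij_betw f (Pow {..<n::nat}) W"
    using xor_space_coordinates[OF assms] by blast
  then have "card W = 2 ^ n"
    by (simp add: card_Pow flip: bij_betw_same_card)
  then show thesis
    by (rule that)
qed

text \<open>Equal cardinality forces equal dimension, so the inverse of one coordinate map can be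
  followed by the other.\<close>

lemma xor_space_iso:
  assumes N: "finite N" and W: "xor_space N W" and W': "xor_space N W'" and "card W = card W'"
  shows "\<exists>h. bij_betw h W W' \<and> xor_hom_on W h"
proof -
  obtain n f where f: "bij_betw f (Pow {..<n::nat}) W" "xor_hom_on (Pow {..<n}) f"
    using xor_space_coordinates[OF N W] by blast
  obtain m g where g: "bij_betw g (Pow {..<m::nat}) W'" "xor_hom_on (Pow {..<m}) g"
    using xor_space_coordinates[OF N W'] by blast
  have "(2::nat) ^ n = 2 ^ m"
    using bij_betw_same_card[OF f(1)] bij_betw_same_card[OF g(1)] assms(4) by (simp add: card_Pow)
  then have [simp]: "m = n"
    by simp
  let ?i = "the_inv_into (Pow {..<n}) f"
  have i: "bij_betw ?i W (Pow {..<n})"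
    using f(1) by (rule bij_betw_the_inv_into)
  have "xor_hom_on W (g \<circ> ?i)"
    unfolding xor_hom_on_def
  proof (intro ballI)
    fix U V assume "U \<in> W" "V \<in> W"
    then obtain A B where AB: "A \<in> Pow {..<n}" "B \<in> Pow {..<n}" "U = f A" "V = f B"
      using f(1) unfolding bij_betw_def by blast
    have "sym_diff A B \<in> Pow {..<n}"
      using AB by blast
    moreover have "sym_diff U V = f (sym_diff A B)"
      using AB xor_hom_onD[OF f(2)] by simp
    ultimately have "?i (sym_diff U V) = sym_diff A B"
      using f(1) by (simp only: bij_betw_def the_inv_into_f_f)
    moreover have "?i U = A" "?i V = B"
      using AB f(1) by (auto simp: bij_betw_def the_inv_into_f_f)
    ultimately show "(g \<circ> ?i) (sym_diff U V) = sym_diff ((g \<circ> ?i) U) ((g \<circ> ?i) V)"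
      using AB xor_hom_onD[OF g(2)] by simp
  qed
  moreover have "bij_betw (g \<circ> ?i) W W'"
    using bij_betw_trans[OF i, of g W'] g(1) by simp
  ultimately show ?thesis
    by blast
qed

section \<open>Gauss coefficients\<close>

text \<open>The whole group is one of the subgroups over which the maximum is taken, and no subgroup
  has more elements.\<close>

lemma two_rank_eq:
  assumes G: "elementary_abelian_2_group G" and card: "card (carrier G) = 2 ^ n"
  shows "two_rank G = n"
proof -
  let ?R = "{n. \<exists>K. subgroup K G \<and> elementary_abelian_2_group (G\<lparr>carrier := K\<rparr>) \<and> card K = 2 ^ n}"
  interpret comm_group G
    using G by (simp add: elementary_abelian_2_group_def)
  have fin: "finite (carrier G)"
    by (rule card_ge_0_finite) (simp add: card)
  have le: "k \<le> n" if k: "k \<in> ?R" for k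
  proof -
    obtain K where "subgroup K G" "card K = 2 ^ k"
      using k by blast
    then have "(2::nat) ^ k \<le> 2 ^ n"
      by (metis card card_mono fin subgroup.subset)
    then show ?thesis
      by simp
  qed
  have "n \<in> ?R"
    using subgroup_self G card by (intro CollectI exI[of _ "carrier G"]) simp
  moreover have "finite ?R"
    using le by (meson finite_nat_set_iff_bounded_le)
  ultimately show ?thesis
    unfolding two_rank_def using le by (intro Max_eqI) auto
qed

lemma elementary_abelian_2_subgroup:
  assumes G: "elementary_abelian_2_group G" and K: "subgroup K G"
  shows "elementary_abelian_2_group (G\<lparr>carrier := K\<rparr>)"
proof -
  interpret comm_group G
    using G by (simp add: elementary_abelian_2_group_def)
  interpret K: group "G\<lparr>carrier := K\<rparr>"
    using K by (rule subgroup_imp_group)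
  have "comm_group (G\<lparr>carrier := K\<rparr>)"
    using subgroup.mem_carrier[OF K] m_comm by (intro K.group_comm_groupI) simp
  then show ?thesis
    using G subgroup.mem_carrier[OF K] by (simp add: elementary_abelian_2_group_def)
qed

text \<open>A vector with entries 0 and 1 is identified with the set of positions of its ones.
  Addition modulo 2 then becomes symmetric difference, so subgroups become spaces, and the 2-rank
  becomes the exponent of the cardinality.\<close>

lemma card_xor_spaces:
  assumes N: "finite N"
  shows "card {W. xor_space N W \<and> card W = 2 ^ r} = gauss_coeff (card N) r"
proof -
  let ?E = "std_elementary_abelian_2_group (card N)"
  interpret group ?E
    by (simp add: std_elementary_abelian_2_group_def)
  obtain b where b: "bij_betw b {..<card N} N"
    using ex_bij_betw_nat_finite[OF N] by (auto simp: atLeast0LessThan)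
  \<comment> \<open>The positions of the ones, carried over to \<open>N\<close> by the enumeration
    \<open>b\<close>.\<close>
  define \<phi> where "\<phi> f = b ` {i \<in> {..<card N}. f i = (1::int)}" for f
  have carrier: "carrier ?E = (\<Pi>\<^sub>E i\<in>{..<card N}. {0, 1})"
  proof -
    have "{0..<2} = {0, 1::int}"
      by auto
    then show ?thesis
      by (simp add: std_elementary_abelian_2_group_def carrier_integer_mod_group)
  qed
  have mem01: "f i = 0 \<or> f i = 1" if "f \<in> carrier ?E" "i < card N" for f i
    using that unfolding carrier by (auto dest!: PiE_mem)
  have mult: "(f \<otimes>\<^bsub>?E\<^esub> g) i = (f i + g i) mod 2" if "i < card N" for f g i
    using that by (simp add: std_elementary_abelian_2_group_def)
  have one: "\<one>\<^bsub>?E\<^esub> i = 0" if "i < card N" for i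
    using that by (simp add: std_elementary_abelian_2_group_def)
  have b_in: "b i \<in> N" if "i < card N" for i
    using b that bij_betwE by blast
  have b_inj: "i = j" if "i < card N" "j < card N" "b i = b j" for i j
    using b that unfolding bij_betw_def inj_on_def by blast
  have \<phi>_iff: "b i \<in> \<phi> f \<longleftrightarrow> f i = 1" if "i < card N" for f i
    using that b_inj by (auto simp: \<phi>_def)
  have \<phi>_sub: "\<phi> f \<subseteq> N" for f
    using b_in by (auto simp: \<phi>_def)
  \<comment> \<open>Subsets of \<open>N\<close> are compared position by position, where membership
    in \<open>\<phi> f\<close> is a condition on one coordinate.\<close>
  have eq_N: "A = B" if "A \<subseteq> N" "B \<subseteq> N" "\<And>i. i < card N \<Longrightarrow> b i \<in> A \<longleftrightarrow> b i \<in> B" for A B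
  proof -
    have "\<exists>i<card N. y = b i" if "y \<in> N" for y
      using b that unfolding bij_betw_def by blast
    then show ?thesis
      using that by blast
  qed
  have \<phi>_mult: "\<phi> (f \<otimes>\<^bsub>?E\<^esub> g) = sym_diff (\<phi> f) (\<phi> g)"
    if fg: "f \<in> carrier ?E" "g \<in> carrier ?E" for f g
  proof (rule eq_N)
    show "\<phi> (f \<otimes>\<^bsub>?E\<^esub> g) \<subseteq> N" "sym_diff (\<phi> f) (\<phi> g) \<subseteq> N"
      using \<phi>_sub by blast+
    show "b i \<in> \<phi> (f \<otimes>\<^bsub>?E\<^esub> g) \<longleftrightarrow> b i \<in> sym_diff (\<phi> f) (\<phi> g)" if "i < card N" for i
      using mem01[OF fg(1) that] mem01[OF fg(2) that] by (auto simp: \<phi>_iff[OF that] mult[OF that])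
  qed
  have \<phi>_one: "\<phi> \<one>\<^bsub>?E\<^esub> = {}"
    by (rule eq_N) (use \<phi>_sub \<phi>_iff one in auto)
  have bij: "bij_betw \<phi> (carrier ?E) (Pow N)"
  proof (rule bij_betwI')
    show "\<phi> f = \<phi> g \<longleftrightarrow> f = g" if fg: "f \<in> carrier ?E" "g \<in> carrier ?E" for f g
    proof
      assume eq: "\<phi> f = \<phi> g"
      show "f = g"
      proof (rule PiE_ext)
        show "f \<in> (\<Pi>\<^sub>E i\<in>{..<card N}. {0, 1})" "g \<in> (\<Pi>\<^sub>E i\<in>{..<card N}. {0, 1})"
          using fg carrier by auto
        show "f i = g i" if "i \<in> {..<card N}" for i
          using that eq \<phi>_iff[of i f] \<phi>_iff[of i g] mem01[OF fg(1)] mem01[OF fg(2)] by fastforce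
      qed
    qed simp
    show "\<phi> f \<in> Pow N" if "f \<in> carrier ?E" for f
      using \<phi>_sub by blast
    show "\<exists>f\<in>carrier ?E. A = \<phi> f" if "A \<in> Pow N" for A
    proof
      let ?f = "\<lambda>i\<in>{..<card N}. if b i \<in> A then 1 else (0::int)"
      show "?f \<in> carrier ?E"
        unfolding carrier by auto
      show "A = \<phi> ?f"
        by (rule eq_N) (use that \<phi>_sub \<phi>_iff in auto)
    qed
  qed
  have closed_iff: "subgroup K ?E \<longleftrightarrow> xor_space N (\<phi> ` K)" if K: "K \<subseteq> carrier ?E" for K
  proof
    assume S: "subgroup K ?E"
    show "xor_space N (\<phi> ` K)"
      unfolding xor_space_def
    proof (intro conjI ballI)
      show "\<phi> ` K \<subseteq> Pow N"
        using \<phi>_sub by blast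
      show "{} \<in> \<phi> ` K"
        using \<phi>_one subgroup.one_closed[OF S] by (metis imageI)
      fix U V assume "U \<in> \<phi> ` K" "V \<in> \<phi> ` K"
      then obtain f g where "f \<in> K" "g \<in> K" "U = \<phi> f" "V = \<phi> g"
        by blast
      then show "sym_diff U V \<in> \<phi> ` K"
        using \<phi>_mult[of f g] K subgroup.m_closed[OF S] by (metis imageI subsetD)
    qed
  next
    assume X: "xor_space N (\<phi> ` K)"
    \<comment> \<open>Injectivity of \<open>\<phi>\<close> allows membership in \<open>K\<close> to
      be tested on images.\<close>
    have mem: "f \<in> K" if "f \<in> carrier ?E" "\<phi> f \<in> \<phi> ` K" for f
      using that K bij inj_on_image_mem_iff unfolding bij_betw_def by metis
    have one_K: "\<one>\<^bsub>?E\<^esub> \<in> K"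
      using mem xor_space_empty[OF X] \<phi>_one by simp
    show "subgroup K ?E"
    proof (rule subgroupI)
      show "K \<subseteq> carrier ?E" "K \<noteq> {}"
        using K one_K by auto
      \<comment> \<open>Every element has square one, hence is its own inverse.\<close>
      show "inv\<^bsub>?E\<^esub> f \<in> K" if "f \<in> K" for f
      proof -
        have "f \<otimes>\<^bsub>?E\<^esub> f = \<one>\<^bsub>?E\<^esub>"
          using elementary_abelian_2_group_std[of "card N"] that K
          unfolding elementary_abelian_2_group_def by blast
        then show ?thesis
          using that K inv_equality by auto
      qed
      show "f \<otimes>\<^bsub>?E\<^esub> g \<in> K" if "f \<in> K" "g \<in> K" for f g
      proof (rule mem)
        have fg: "f \<in> carrier ?E" "g \<in> carrier ?E"
          using that K by auto
        then show "f \<otimes>\<^bsub>?E\<^esub> g \<in> carrier ?E"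
          by simp
        show "\<phi> (f \<otimes>\<^bsub>?E\<^esub> g) \<in> \<phi> ` K"
          unfolding \<phi>_mult[OF fg] using that by (intro xor_space_sym_diff[OF X] imageI)
      qed
    qed
  qed
  have rank_iff: "two_rank (?E\<lparr>carrier := K\<rparr>) = r \<longleftrightarrow> card (\<phi> ` K) = 2 ^ r"
    if K: "subgroup K ?E" for K
  proof -
    have sub: "K \<subseteq> carrier ?E"
      using subgroup.subset[OF K] .
    then obtain n where n: "card (\<phi> ` K) = 2 ^ n"
      using card_xor_space[OF N] K closed_iff by blast
    have "card (\<phi> ` K) = card K"
      using bij sub inj_on_subset unfolding bij_betw_def by (metis card_image)
    then have "two_rank (?E\<lparr>carrier := K\<rparr>) = n"
      using n K by (intro two_rank_eq elementary_abelian_2_subgroup elementary_abelian_2_group_std) auto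
    then show ?thesis
      using n by simp
  qed
  have bij_sets: "bij_betw (image \<phi>) (Pow (carrier ?E)) (Pow (Pow N))"
    using bij by (rule bij_betw_Pow)
  have "image \<phi> ` {K. subgroup K ?E \<and> two_rank (?E\<lparr>carrier := K\<rparr>) = r}
    = {W. xor_space N W \<and> card W = 2 ^ r}"
  proof (intro equalityI subsetI)
    fix W assume "W \<in> image \<phi> ` {K. subgroup K ?E \<and> two_rank (?E\<lparr>carrier := K\<rparr>) = r}"
    then obtain K where K: "subgroup K ?E" "two_rank (?E\<lparr>carrier := K\<rparr>) = r" "W = \<phi> ` K"
      by blast
    then show "W \<in> {W. xor_space N W \<and> card W = 2 ^ r}"
      using rank_iff[OF K(1)] closed_iff[OF subgroup.subset[OF K(1)]] by simp
  next
    fix W assume W: "W \<in> {W. xor_space N W \<and> card W = 2 ^ r}"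
    then have "W \<in> Pow (Pow N)"
      using xor_space_subset[of N W] by simp
    then have "W \<in> image \<phi> ` Pow (carrier ?E)"
      using bij_sets by (simp only: bij_betw_def)
    then obtain K where K: "K \<subseteq> carrier ?E" "W = \<phi> ` K"
      by blast
    then have "subgroup K ?E"
      using W closed_iff[OF K(1)] by simp
    then have "K \<in> {K. subgroup K ?E \<and> two_rank (?E\<lparr>carrier := K\<rparr>) = r}"
      using K W rank_iff[of K] by simp
    then show "W \<in> image \<phi> ` {K. subgroup K ?E \<and> two_rank (?E\<lparr>carrier := K\<rparr>) = r}"
      unfolding K(2) by (rule imageI)
  qed
  moreover have "inj_on (image \<phi>) {K. subgroup K ?E \<and> two_rank (?E\<lparr>carrier := K\<rparr>) = r}"
    using bij_sets unfolding bij_betw_def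
    by (rule conjunct1[THEN inj_on_subset]) (use subgroup.subset in blast)
  ultimately have "card {W. xor_space N W \<and> card W = 2 ^ r}
      = card {K. subgroup K ?E \<and> two_rank (?E\<lparr>carrier := K\<rparr>) = r}"
    using card_image by fastforce
  then show ?thesis
    by (simp only: gauss_coeff_def Let_def)
qed

text \<open>The classes are the nonempty fibres of \<open>k\<close>, one for each value taken. This
  reduces counting isomorphism classes to counting values of invariants.\<close>

lemma card_quotient_kernel:
  "card (A // {(a, b). a \<in> A \<and> b \<in> A \<and> k a = k b}) = card (k ` A)"
proof -
  let ?R = "{(a, b). a \<in> A \<and> b \<in> A \<and> k a = k b}"
  have R: "?R `` {a} = {b \<in> A. k b = k a}" if "a \<in> A" for a
    using that by auto
  have "A // ?R = (\<lambda>v. {b \<in> A. k b = v}) ` k ` A"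
    unfolding quotient_def using R by auto
  moreover have "inj_on (\<lambda>v. {b \<in> A. k b = v}) (k ` A)"
    by (rule inj_onI) blast
  ultimately show ?thesis
    by (simp add: card_image)
qed

lemma inj_on_image_subset_iff:
  assumes "inj_on f C" "A \<subseteq> C" "B \<subseteq> C"
  shows "f ` A \<subseteq> f ` B \<longleftrightarrow> A \<subseteq> B"
proof
  assume sub: "f ` A \<subseteq> f ` B"
  show "A \<subseteq> B"
  proof
    fix a assume a: "a \<in> A"
    then obtain b where "b \<in> B" "f a = f b"
      using sub by blast
    then show "a \<in> B"
      using assms a inj_onD[OF assms(1), of a b] by auto
  qed
qed blast

section \<open>Encoding by subsets of the index set\<close>

locale elementary_abelian_2_hyp =
  fixes H :: "('a, 'b) hyperstructure_scheme" and p :: nat and q :: "nat \<Rightarrow> 'a"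
  assumes elementary_abelian: "elementary_abelian_2_hypergroup H p q"
begin

sublocale hypergroup H
  using elementary_abelian by (simp add: elementary_abelian_2_hypergroup_def)

declare upt_Suc [simp del]

abbreviation I where "I \<equiv> {1..p}"

abbreviation Q where "Q i \<equiv> {e, q i}"

text \<open>The cofactor of index \<open>i\<close>, with each \<open>closed_gen H (q j)\<close>
  already replaced by the pair \<open>Q j\<close>.\<close>

definition cof where "cof i = hprod_list H (map Q [j \<leftarrow> [1..<Suc p]. j \<noteq> i])"

definition T where "T = {i \<in> I. thick H (q i)}"

text \<open>The component function of the element whose support is indexed by
  \<open>A\<close>.\<close>

definition word where "word A i = (if i \<in> A then q i else e)"

text \<open>The encoding of elements by index sets. Using \<open>the_elem\<close> is legitimate
  because the product of a word is a singleton, which rests on the direct product being constrained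
  (\<open>elem_prod_singleton\<close>).\<close>

definition x where "x A = the_elem (elem_prod H p (word A))"

lemma involution_q: "i \<in> I \<Longrightarrow> involution H (q i)"
  using elementary_abelian by (simp add: elementary_abelian_2_hypergroup_def)

lemma q_carrier [simp]: "i \<in> I \<Longrightarrow> q i \<in> carrier H"
  and q_neq [simp]: "i \<in> I \<Longrightarrow> q i \<noteq> e"
  using involution_q by (auto simp: involution_def)

lemma Q_carrier: "i \<in> I \<Longrightarrow> Q i \<subseteq> carrier H"
  using q_carrier neutral_in by blast

lemma closed_gen_q: "i \<in> I \<Longrightarrow> closed_gen H (q i) = Q i"
  using involution_q closed_gen_eq by blast

lemma cofactor_eq: "i \<in> I \<Longrightarrow> cofactor H p (\<lambda>i. closed_gen H (q i)) i = cof i"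
  unfolding cofactor_def cof_def
  by (rule arg_cong[where f = "hprod_list H"], rule map_cong) (auto intro!: closed_gen_q)

lemma
  shows p_pos: "1 \<le> p"
    and normal_Q: "i \<in> I \<Longrightarrow> normal_closed_subset H (Q i)"
    and carrier_eq: "i \<in> I \<Longrightarrow> carrier H = Q i \<odot> cof i"
    and Q_Int_cof: "i \<in> I \<Longrightarrow> Q i \<inter> cof i = {e}"
proof -
  have dp: "direct_product H p (\<lambda>i. closed_gen H (q i))"
    using elementary_abelian
    by (simp add: elementary_abelian_2_hypergroup_def constrained_direct_product_def)
  then show "1 \<le> p"
    by (simp add: direct_product_def)
  assume i: "i \<in> I"
  have "normal_closed_subset H (closed_gen H (q i))"
    "carrier H = hprod H (closed_gen H (q i)) (cofactor H p (\<lambda>i. closed_gen H (q i)) i)"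
    "closed_gen H (q i) \<inter> cofactor H p (\<lambda>i. closed_gen H (q i)) i = {e}"
    using dp i unfolding direct_product_def by blast+
  then show "normal_closed_subset H (Q i)" "carrier H = Q i \<odot> cof i" "Q i \<inter> cof i = {e}"
    unfolding closed_gen_q[OF i] cofactor_eq[OF i] .
qed

lemma normal_closed_cof: "normal_closed_subset H (cof i)"
  unfolding cof_def by (rule normal_closed_hprod_list) (use normal_Q in auto)

lemma cof_carrier: "cof i \<subseteq> carrier H"
  using normal_closed_cof closed_subset_carrier by (simp add: normal_closed_subset_def)

section \<open>Existence and uniqueness of components\<close>

lemma upt_split:
  assumes "i \<in> I"
  shows "[1..<Suc p] = [1..<i] @ i # [Suc i..<Suc p]"
  using assms upt_add_eq_append[of 1 i "Suc p - i"] upt_conv_Cons[of i "Suc p"] by simp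

lemma hprod_list_split:
  assumes i: "i \<in> I" and F: "\<And>j. j \<in> I \<Longrightarrow> F j \<subseteq> carrier H"
  shows "hprod_list H (map F [1..<Suc p])
    = hprod_list H (map F [1..<i]) \<odot> (F i \<odot> hprod_list H (map F [Suc i..<Suc p]))"
proof -
  have "hprod_list H (map F [1..<i] @ map F (i # [Suc i..<Suc p]))
    = hprod_list H (map F [1..<i]) \<odot> hprod_list H (map F (i # [Suc i..<Suc p]))"
  proof (rule hprod_list_append)
    have "F j \<subseteq> carrier H" if "j \<in> set [1..<i] \<union> set (i # [Suc i..<Suc p])" for j
      using that i by (intro F) auto
    then show "\<forall>F\<in>set (map F [1..<i]). F \<subseteq> carrier H"
      "\<forall>F\<in>set (map F (i # [Suc i..<Suc p])). F \<subseteq> carrier H"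
      by (simp_all)
  qed
  then show ?thesis
    by (simp only: upt_split[OF i] map_append list.map hprod_list_Cons)
qed

lemma hprod_list_Q:
  assumes i: "i \<in> I"
  shows "cof i = hprod_list H (map Q [1..<i]) \<odot> hprod_list H (map Q [Suc i..<Suc p])"
proof -
  have "[j \<leftarrow> [1..<Suc p]. j \<noteq> i] = [1..<i] @ [Suc i..<Suc p]"
    unfolding upt_split[OF i] by (auto simp: filter_id_conv)
  then show ?thesis
    unfolding cof_def using i Q_carrier
    by (simp only: map_append) (intro hprod_list_append; simp)
qed

lemma hprod_list_Q_carrier:
  "set js \<subseteq> I \<Longrightarrow> hprod_list H (map Q js) \<subseteq> carrier H"
  by (intro hprod_list_map_closed Q_carrier) blast

text \<open>Normality of the product of the first factors moves \<open>r i\<close> to the front.\<close>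

lemma elem_prod_subset_cof:
  assumes i: "i \<in> I" and r: "\<And>j. j \<in> I \<Longrightarrow> r j \<in> Q j"
  shows "elem_prod H p r \<subseteq> {r i} \<odot> cof i"
proof -
  let ?L = "hprod_list H (map Q [1..<i])" and ?R = "hprod_list H (map Q [Suc i..<Suc p])"
  have sub: "?L \<subseteq> carrier H" "?R \<subseteq> carrier H" "{r i} \<subseteq> carrier H"
    using i r[OF i] by (auto intro!: hprod_list_Q_carrier)
  have "elem_prod H p r
    = hprod_list H (map (\<lambda>j. {r j}) [1..<i]) \<odot> ({r i} \<odot> hprod_list H (map (\<lambda>j. {r j}) [Suc i..<Suc p]))"
    unfolding elem_prod_def by (rule hprod_list_split) (use i r Q_carrier in blast)+
  also have "\<dots> \<subseteq> ?L \<odot> ({r i} \<odot> ?R)"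
    using i r by (intro hprod_mono hprod_list_mono) auto
  also have "\<dots> = ?L \<odot> {r i} \<odot> ?R"
    using sub by (intro set_prod_assoc[symmetric])
  also have "?L \<odot> {r i} = {r i} \<odot> ?L"
    using i sub normal_Q by (intro normal_commute normal_closed_hprod_list) auto
  also have "{r i} \<odot> ?L \<odot> ?R = {r i} \<odot> cof i"
    unfolding hprod_list_Q[OF i] using sub by (intro set_prod_assoc)
  finally show ?thesis .
qed

text \<open>Write a in (r i)b and in (s i)c with b, c in \<open>cof i\<close>. Associativity yields
  d in the product of \<open>star H (r i)\<close> and \<open>s i\<close> with b in dc. This d lies
  in \<open>Q i\<close>, and by exchange also in \<open>cof i\<close>, so it is \<open>e\<close>,
  which forces \<open>r i = s i\<close>.\<close>

lemma elem_prod_unique: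
  assumes "a \<in> elem_prod H p r" "a \<in> elem_prod H p s" and i: "i \<in> I"
    and r: "\<And>j. j \<in> I \<Longrightarrow> r j \<in> Q j" and s: "\<And>j. j \<in> I \<Longrightarrow> s j \<in> Q j"
  shows "r i = s i"
proof -
  obtain b c where b: "b \<in> cof i" "a \<in> hmult H (r i) b" and c: "c \<in> cof i" "a \<in> hmult H (s i) c"
    using assms elem_prod_subset_cof[of i r] elem_prod_subset_cof[of i s]
    unfolding mem_hprod subset_iff by (metis singletonD)
  have car: "b \<in> carrier H" "c \<in> carrier H" "r i \<in> carrier H" "s i \<in> carrier H"
    using b c cof_carrier r[OF i] s[OF i] Q_carrier[OF i] by auto
  then have a: "a \<in> carrier H" and star_r: "star H (r i) \<in> carrier H"
    using hmult_closed b star_closed by blast+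
  have "b \<in> hmult H (star H (r i)) a"
    using exchange2 a car b by blast
  then have "b \<in> {star H (r i)} \<odot> hmult H (s i) c"
    using c by (auto simp: mem_hprod)
  then have "b \<in> hmult H (star H (r i)) (s i) \<odot> {c}"
    using assoc car star_r by simp
  then obtain d where d: "d \<in> hmult H (star H (r i)) (s i)" "b \<in> hmult H d c"
    by (auto simp: mem_hprod)
  then have d_car: "d \<in> carrier H"
    using hmult_closed star_r car by blast
  then have "d \<in> hmult H b (star H c)"
    using d exchange1 car by blast
  then have "d \<in> cof i"
    using closed_subset_hmult closed_subset_star normal_closed_cof b c
    unfolding normal_closed_subset_def by blast
  moreover have "d \<in> Q i"
    using d closed_subset_hmult closed_subset_star normal_Q[OF i] r[OF i] s[OF i]
    unfolding normal_closed_subset_def by blast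
  ultimately have "d = e"
    using Q_Int_cof[OF i] by blast
  then have "s i \<in> hmult H (star H (star H (r i))) e"
    using exchange2 d car star_r by auto
  then show ?thesis
    using star_star car by simp
qed

text \<open>One index suffices: for index 1 the cofactor is the product of the remaining factors in
  order, so \<open>carrier H\<close> is the product of all \<open>Q i\<close>.\<close>

lemma ex_elem_prod:
  assumes "a \<in> carrier H"
  shows "\<exists>r. (\<forall>j\<in>I. r j \<in> Q j) \<and> a \<in> elem_prod H p r"
proof -
  have 1: "1 \<in> I"
    using p_pos by simp
  let ?R = "hprod_list H (map Q [Suc 1..<Suc p])"
  have R: "?R \<subseteq> carrier H"
    by (rule hprod_list_Q_carrier) auto
  have "hprod_list H (map Q [1..<Suc p]) = {e} \<odot> (Q 1 \<odot> ?R)"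
    using hprod_list_split[OF 1, of Q] Q_carrier by simp
  moreover have "cof 1 = {e} \<odot> ?R"
    using hprod_list_Q[OF 1] by simp
  ultimately have "hprod_list H (map Q [1..<Suc p]) = Q 1 \<odot> cof 1"
    using R Q_carrier[OF 1] set_prod_closed[OF Q_carrier[OF 1] R] by (simp only: set_prod_neutral)
  then have "a \<in> hprod_list H (map Q [1..<Suc p])"
    using carrier_eq[OF 1] assms by simp
  then show ?thesis
    using mem_hprod_list[of "[1..<Suc p]" a Q]
    by (simp only: distinct_upt elem_prod_def set_upt atLeastLessThanSuc_atLeastAtMost)
qed

lemma elem_prod_cong: "(\<And>i. i \<in> I \<Longrightarrow> r i = s i) \<Longrightarrow> elem_prod H p r = elem_prod H p s"
  unfolding elem_prod_def by (rule arg_cong[where f = "hprod_list H"], rule map_cong) auto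

text \<open>Uniqueness turns the definite description into any known factorization;
  \<open>restrict\<close> fixes the values outside \<open>I\<close>.\<close>

lemma components_eq:
  assumes r: "\<And>j. j \<in> I \<Longrightarrow> r j \<in> Q j" and a: "a \<in> elem_prod H p r"
  shows "components H p (\<lambda>i. closed_gen H (q i)) a = restrict r I"
proof -
  have Pi: "(\<Pi>\<^sub>E i\<in>I. closed_gen H (q i)) = (\<Pi>\<^sub>E i\<in>I. Q i)"
    by (rule PiE_cong) (rule closed_gen_q)
  show ?thesis
    unfolding components_def Pi
  proof (rule the_equality)
    show "restrict r I \<in> (\<Pi>\<^sub>E i\<in>I. Q i) \<and> a \<in> elem_prod H p (restrict r I)"
      using assms elem_prod_cong[of "restrict r I" r] by (simp only: restrict_PiE_iff) auto
    show "s = restrict r I" if s: "s \<in> (\<Pi>\<^sub>E i\<in>I. Q i) \<and> a \<in> elem_prod H p s" for s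
    proof (rule PiE_ext)
      show "s \<in> (\<Pi>\<^sub>E i\<in>I. Q i)" "restrict r I \<in> (\<Pi>\<^sub>E i\<in>I. Q i)"
        using s r by (blast, simp only: restrict_PiE_iff, blast)
      show "s i = restrict r I i" if "i \<in> I" for i
        using elem_prod_unique[of a s r i] s a r that PiE_mem[of s I Q] by simp
    qed
  qed
qed

lemma elem_prod_carrier:
  assumes "\<And>j. j \<in> I \<Longrightarrow> r j \<in> Q j"
  shows "elem_prod H p r \<subseteq> carrier H"
  unfolding elem_prod_def using assms Q_carrier by (intro hprod_list_map_closed) fastforce

text \<open>The product is nonempty. The components of any member \<open>a\<close> are given by
  \<open>r\<close>, so the constraint on the direct product, applied to \<open>a\<close>, speaks of
  this very product.\<close>

lemma elem_prod_singleton: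
  assumes r: "\<And>j. j \<in> I \<Longrightarrow> r j \<in> Q j"
  shows "\<exists>a. elem_prod H p r = {a}"
proof -
  have "elem_prod H p r \<noteq> {}"
    unfolding elem_prod_def by (rule hprod_list_nonempty) (use assms Q_carrier in fastforce)
  then obtain a where a: "a \<in> elem_prod H p r"
    by blast
  then have "a \<in> carrier H"
    using elem_prod_carrier[OF r] by blast
  then have "elem_prod H p (components H p (\<lambda>i. closed_gen H (q i)) a) = {a}"
    using elementary_abelian
    by (simp add: elementary_abelian_2_hypergroup_def constrained_direct_product_def)
  then show ?thesis
    using components_eq[OF r a] elem_prod_cong[of "restrict r I" r] by auto
qed

section \<open>The encoding and its bijectivity\<close>

lemma word_Q: "word A i \<in> Q i"
  by (simp add: word_def)

lemma elem_prod_word: "elem_prod H p (word A) = {x A}"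
  using elem_prod_singleton[of "word A", OF word_Q] unfolding x_def by (metis the_elem_eq)

lemma components_x: "components H p (\<lambda>i. closed_gen H (q i)) (x A) = restrict (word A) I"
  using components_eq[of "word A", OF word_Q] elem_prod_word by blast

text \<open>As \<open>Q i\<close> has only the members \<open>e\<close> and \<open>q i\<close>, on
  \<open>I\<close> the function \<open>r\<close> is the word of the positions where it is not
  \<open>e\<close>.\<close>

lemma elem_prod_eq_x:
  assumes "\<And>j. j \<in> I \<Longrightarrow> r j \<in> Q j"
  shows "elem_prod H p r = {x {i \<in> I. r i \<noteq> e}}"
proof -
  have "elem_prod H p r = elem_prod H p (word {i \<in> I. r i \<noteq> e})"
    by (rule elem_prod_cong) (use assms in \<open>auto simp: word_def\<close>)
  then show ?thesis
    by (simp add: elem_prod_word)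
qed

lemma word_inj:
  assumes "A \<subseteq> I" "B \<subseteq> I" "\<And>i. i \<in> I \<Longrightarrow> word A i = word B i"
  shows "A = B"
proof -
  have "i \<in> A \<longleftrightarrow> i \<in> B" if "i \<in> I" for i
    using assms(3)[OF that] q_neq[OF that] by (auto simp: word_def split: if_splits)
  then show ?thesis
    using assms by blast
qed

text \<open>Uniqueness of components gives injectivity, existence of components gives
  surjectivity.\<close>

lemma bij_x: "bij_betw x (Pow I) (carrier H)"
proof (rule bij_betwI')
  fix A B assume "A \<in> Pow I" "B \<in> Pow I"
  then have AB: "A \<subseteq> I" "B \<subseteq> I"
    by auto
  have "A = B" if eq: "x A = x B"
  proof (rule word_inj[OF AB])
    show "word A i = word B i" if "i \<in> I" for i
      using elem_prod_unique[of "x A" "word A" "word B" i] that word_Q elem_prod_word eq by simp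
  qed
  then show "x A = x B \<longleftrightarrow> A = B"
    by blast
next
  show "x A \<in> carrier H" if "A \<in> Pow I" for A
    using elem_prod_carrier[of "word A", OF word_Q] elem_prod_word by blast
next
  fix a assume "a \<in> carrier H"
  then obtain r where "\<forall>j\<in>I. r j \<in> Q j" "a \<in> elem_prod H p r"
    using ex_elem_prod by blast
  then show "\<exists>A\<in>Pow I. a = x A"
    using elem_prod_eq_x[of r] by (intro bexI[of _ "{i \<in> I. r i \<noteq> e}"]) auto
qed

lemma x_carrier [simp]: "x A \<in> carrier H"
  using elem_prod_carrier[of "word A", OF word_Q] elem_prod_word by blast

lemma x_surj: "a \<in> carrier H \<Longrightarrow> \<exists>A. A \<subseteq> I \<and> a = x A"
  using bij_x unfolding bij_betw_def by (metis PowD imageE)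

lemma x_eq_iff: "A \<subseteq> I \<Longrightarrow> B \<subseteq> I \<Longrightarrow> x A = x B \<longleftrightarrow> A = B"
  using bij_x by (auto simp: bij_betw_def inj_on_eq_iff)

lemma hprod_list_neutral: "(\<And>j. j \<in> set js \<Longrightarrow> r j = e) \<Longrightarrow> hprod_list H (map (\<lambda>j. {r j}) js) = {e}"
  by (induction js) simp_all

lemma x_singleton:
  assumes i: "i \<in> I"
  shows "x {i} = q i"
proof -
  have "elem_prod H p (word {i}) = hprod_list H (map (\<lambda>j. {word {i} j}) [1..<i]) \<odot>
      ({word {i} i} \<odot> hprod_list H (map (\<lambda>j. {word {i} j}) [Suc i..<Suc p]))"
    unfolding elem_prod_def by (rule hprod_list_split[OF i]) (simp add: word_def)
  also have "\<dots> = {e} \<odot> ({q i} \<odot> {e})"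
    by (subst (1 2) hprod_list_neutral) (auto simp: word_def)
  also have "\<dots> = {q i}"
    using i by simp
  finally have "elem_prod H p (word {i}) = {q i}" .
  then show ?thesis
    by (simp add: elem_prod_word)
qed

lemma x_empty [simp]: "x {} = e"
  using elem_prod_word[of "{}"] unfolding elem_prod_def by (simp add: word_def hprod_list_neutral)

lemma inj_q: "inj_on q I"
proof (rule inj_onI)
  fix i j assume ij: "i \<in> I" "j \<in> I" "q i = q j"
  then have "x {i} = x {j}"
    by (simp add: x_singleton)
  then show "i = j"
    using ij x_eq_iff[of "{i}" "{j}"] by auto
qed

section \<open>The multiplication rule for index sets\<close>

lemma star_q:
  assumes i: "i \<in> I"
  shows "star H (q i) = q i"
proof -
  have "star H (q i) \<in> Q i"
    using closed_subset_star[of "Q i" "q i"] normal_Q[OF i] by (simp add: normal_closed_subset_def)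
  moreover have "star H (q i) \<noteq> e"
  proof
    assume "star H (q i) = e"
    then show False
      using star_star[OF q_carrier[OF i]] q_neq[OF i] star_neutral by metis
  qed
  ultimately show ?thesis
    by simp
qed

text \<open>Closedness of \<open>Q i\<close> and \<open>star H (q i) = q i\<close> leave only
  \<open>{e}\<close> and \<open>Q i\<close> as the square of \<open>q i\<close>; thinness decides
  between them.\<close>

lemma hmult_q:
  assumes i: "i \<in> I"
  shows "hmult H (q i) (q i) = (if i \<in> T then Q i else {e})"
proof -
  have "hmult H (q i) (q i) \<subseteq> Q i"
    using closed_subset_hmult normal_Q[OF i] by (simp add: normal_closed_subset_def)
  moreover have "e \<in> hmult H (q i) (q i)"
    using neutral_in_star_hmult[of "q i"] star_q[OF i] i by simp
  moreover have "i \<in> T \<longleftrightarrow> hmult H (q i) (q i) \<noteq> {e}"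
    using i by (simp add: T_def thin_def star_q)
  ultimately show ?thesis
    by auto
qed

text \<open>Normality of \<open>Q i\<close> makes the two products equal after adding
  \<open>q j\<close> to both. Neither contains \<open>q j\<close>: by exchange \<open>q i\<close>
  would lie in the square of \<open>q j\<close>, which is inside \<open>Q j\<close>.\<close>

lemma q_commute:
  assumes i: "i \<in> I" and j: "j \<in> I"
  shows "hmult H (q i) (q j) = hmult H (q j) (q i)"
proof (cases "i = j")
  case False
  then have "q i \<noteq> q j"
    using inj_q i j by (auto dest: inj_onD)
  then have nin: "q i \<notin> hmult H (q j) (q j)"
    using hmult_q[OF j] i by auto
  have "q j \<notin> hmult H (q i) (q j)" "q j \<notin> hmult H (q j) (q i)"
    using nin exchange1[of "q j" "q i" "q j"] exchange2[of "q j" "q j" "q i"] i j star_q by auto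
  moreover have "insert (q j) (hmult H (q i) (q j)) = insert (q j) (hmult H (q j) (q i))"
  proof -
    have "Q i \<odot> {q j} = {q j} \<odot> Q i"
      using i j by (intro normal_commute normal_Q) auto
    then show ?thesis
      using j unfolding hprod_def by simp
  qed
  ultimately show ?thesis
    using insert_ident by metis
qed simp

lemma word_commute:
  "i \<in> I \<Longrightarrow> j \<in> I \<Longrightarrow> hmult H (word A i) (word B j) = hmult H (word B j) (word A i)"
  using q_commute by (simp add: word_def)

lemma word_carrier: "i \<in> I \<Longrightarrow> word A i \<in> carrier H"
  by (simp add: word_def)

text \<open>The product at a single index. It is forced except when \<open>i\<close> lies in
  \<open>A \<inter> B \<inter> T\<close>, where both \<open>e\<close> and \<open>q i\<close>
  occur.\<close>

lemma word_hmult: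
  assumes i: "i \<in> I"
  shows "word C i \<in> hmult H (word A i) (word B i) \<longleftrightarrow>
    (if i \<in> C then i \<in> sym_diff A B \<union> (A \<inter> B \<inter> T) else i \<notin> sym_diff A B)"
  using i q_neq[OF i] q_neq[OF i, symmetric] by (auto simp: word_def hmult_q)

lemma x_mem_hmult:
  assumes "A \<subseteq> I" "B \<subseteq> I" "C \<subseteq> I"
  shows "x C \<in> hmult H (x A) (x B) \<longleftrightarrow>
    sym_diff A B \<subseteq> C \<and> C \<subseteq> sym_diff A B \<union> (A \<inter> B \<inter> T)"
proof -
  have "hmult H (x A) (x B) = elem_prod H p (word A) \<odot> elem_prod H p (word B)"
    by (simp add: elem_prod_word)
  also have "\<dots> = hprod_list H (map (\<lambda>i. {word A i} \<odot> {word B i}) [1..<Suc p])"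
    unfolding elem_prod_def
    by (rule hprod_list_mult) (use word_carrier word_commute in auto)
  finally have "x C \<in> hmult H (x A) (x B) \<longleftrightarrow>
      (\<exists>r. (\<forall>i\<in>I. r i \<in> hmult H (word A i) (word B i)) \<and> x C \<in> elem_prod H p r)"
    using mem_hprod_list[of "[1..<Suc p]" "x C" "\<lambda>i. {word A i} \<odot> {word B i}"]
    by (simp add: elem_prod_def atLeastLessThanSuc_atLeastAtMost)
  \<comment> \<open>By uniqueness of components, any admissible \<open>r\<close> agrees with
    \<open>word C\<close> on \<open>I\<close>.\<close>
  also have "\<dots> \<longleftrightarrow> (\<forall>i\<in>I. word C i \<in> hmult H (word A i) (word B i))"
  proof
    assume "\<exists>r. (\<forall>i\<in>I. r i \<in> hmult H (word A i) (word B i)) \<and> x C \<in> elem_prod H p r"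
    then obtain r where r: "\<And>i. i \<in> I \<Longrightarrow> r i \<in> hmult H (word A i) (word B i)"
        "x C \<in> elem_prod H p r"
      by blast
    have "r i \<in> Q i" if "i \<in> I" for i
      using closed_subset_hmult normal_Q[OF that] word_Q r(1)[OF that]
      unfolding normal_closed_subset_def by blast
    then have "r i = word C i" if "i \<in> I" for i
      using elem_prod_unique[OF r(2) _ that, of "word C"] word_Q elem_prod_word by simp
    then show "\<forall>i\<in>I. word C i \<in> hmult H (word A i) (word B i)"
      using r by metis
  qed (use elem_prod_word in blast)
  also have "\<dots> \<longleftrightarrow> sym_diff A B \<subseteq> C \<and> C \<subseteq> sym_diff A B \<union> (A \<inter> B \<inter> T)"
  proof -
    have "(\<forall>i\<in>I. word C i \<in> hmult H (word A i) (word B i)) \<longleftrightarrow>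
        (\<forall>i\<in>I. if i \<in> C then i \<in> sym_diff A B \<union> (A \<inter> B \<inter> T) else i \<notin> sym_diff A B)"
      by (intro ball_cong refl word_hmult)
    also have "\<dots> \<longleftrightarrow>
        (\<forall>i\<in>I. (i \<in> C \<longrightarrow> i \<in> sym_diff A B \<union> (A \<inter> B \<inter> T)) \<and> (i \<in> sym_diff A B \<longrightarrow> i \<in> C))"
      by (intro ball_cong refl) (simp only: if_bool_eq_conj, blast)
    also have "\<dots> \<longleftrightarrow> sym_diff A B \<subseteq> C \<and> C \<subseteq> sym_diff A B \<union> (A \<inter> B \<inter> T)"
      unfolding Ball_def subset_eq using assms[THEN subsetD] by blast
    finally show ?thesis .
  qed
  finally show ?thesis .
qed

section \<open>Closed subsets\<close>

definition N where "N = I - T"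

text \<open>The index sets of a closed subset, thick and thin parts being independent of each other;
  \<open>closed_subset_is_box\<close> shows that every closed subset has this shape.\<close>

definition box where "box S W = {A. A \<subseteq> I \<and> A \<inter> T \<subseteq> S \<and> A - T \<in> W}"

lemma T_subset: "T \<subseteq> I"
  by (auto simp: T_def)

lemma finite_T: "finite T" and finite_N: "finite N"
  using T_subset finite_subset by (auto simp: N_def)

lemma box_subset: "box S W \<subseteq> Pow I"
  by (auto simp: box_def)

lemma hmult_x:
  assumes "A \<subseteq> I" "B \<subseteq> I"
  shows "hmult H (x A) (x B) = x ` {C. sym_diff A B \<subseteq> C \<and> C \<subseteq> sym_diff A B \<union> (A \<inter> B \<inter> T)}"
proof (intro equalityI subsetI)
  fix a assume a: "a \<in> hmult H (x A) (x B)"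
  then have "a \<in> carrier H"
    using hmult_closed[of "x A" "x B"] by auto
  then obtain C where "C \<subseteq> I" "a = x C"
    using x_surj by blast
  then show "a \<in> x ` {C. sym_diff A B \<subseteq> C \<and> C \<subseteq> sym_diff A B \<union> (A \<inter> B \<inter> T)}"
    using a x_mem_hmult[OF assms] by blast
next
  fix a assume "a \<in> x ` {C. sym_diff A B \<subseteq> C \<and> C \<subseteq> sym_diff A B \<union> (A \<inter> B \<inter> T)}"
  then obtain C where C: "sym_diff A B \<subseteq> C" "C \<subseteq> sym_diff A B \<union> (A \<inter> B \<inter> T)" "a = x C"
    by blast
  then have "C \<subseteq> I"
    using assms by blast
  then show "a \<in> hmult H (x A) (x B)"
    using x_mem_hmult[OF assms] C by simp
qed

lemma hmult_x_self: "A \<subseteq> I \<Longrightarrow> hmult H (x A) (x A) = x ` Pow (A \<inter> T)"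
  by (simp add: hmult_x Pow_def)

text \<open>As \<open>e\<close> lies in the square of \<open>x A\<close>, an exchange puts
  \<open>x A\<close> into the product of \<open>e\<close> and \<open>star H (x A)\<close>.\<close>

lemma star_x:
  assumes "A \<subseteq> I"
  shows "star H (x A) = x A"
proof -
  have "e \<in> hmult H (x A) (x A)"
    using x_mem_hmult[OF assms assms, of "{}"] by simp
  then have "x A \<in> hmult H e (star H (x A))"
    using exchange1[of e "x A" "x A"] by simp
  then show ?thesis
    using star_closed by simp
qed

text \<open>The square of \<open>x A\<close> consists of all \<open>x B\<close> with
  \<open>B \<subseteq> A \<inter> T\<close>.\<close>

lemma thin_x_iff:
  assumes "A \<subseteq> I"
  shows "thin H (x A) \<longleftrightarrow> A \<inter> T = {}"
proof -
  have "thin H (x A) \<longleftrightarrow> x ` Pow (A \<inter> T) = {x {}}"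
    using assms by (simp add: thin_def star_x hmult_x_self)
  also have "\<dots> \<longleftrightarrow> A \<inter> T = {}"
  proof
    assume "x ` Pow (A \<inter> T) = {x {}}"
    then have "x (A \<inter> T) = x {}"
      by blast
    then show "A \<inter> T = {}"
      using assms x_eq_iff[of "A \<inter> T" "{}"] by blast
  qed simp
  finally show ?thesis .
qed

text \<open>Multiplication keeps the thick part within the union of the two thick parts and takes
  the symmetric difference of the thin parts.\<close>

lemma closed_subset_box:
  assumes S: "S \<subseteq> T" and W: "xor_space N W"
  shows "closed_subset H (x ` box S W)"
proof (rule closed_subsetI)
  show "x ` box S W \<subseteq> carrier H"
    by auto
  have "{} \<in> box S W"
    using xor_space_empty[OF W] by (simp add: box_def)
  then show "e \<in> x ` box S W"
    using x_empty by force
  show "star H a \<in> x ` box S W" if "a \<in> x ` box S W" for a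
    using that star_x by (auto simp: box_def)
  show "hmult H a b \<subseteq> x ` box S W" if "a \<in> x ` box S W" "b \<in> x ` box S W" for a b
  proof -
    obtain A B where A: "A \<in> box S W" "a = x A" and B: "B \<in> box S W" "b = x B"
      using \<open>a \<in> x ` box S W\<close> \<open>b \<in> x ` box S W\<close> by blast
    have "C \<in> box S W" if C: "sym_diff A B \<subseteq> C" "C \<subseteq> sym_diff A B \<union> (A \<inter> B \<inter> T)" for C
    proof -
      have "C - T = sym_diff (A - T) (B - T)"
        using C by blast
      then have "C - T \<in> W"
        using A B xor_space_sym_diff[OF W] by (simp add: box_def)
      then show ?thesis
        using A B C unfolding box_def by blast
    qed
    then show ?thesis
      using A B hmult_x[of A B] by (auto simp: box_def)
  qed
qed

text \<open>Inside \<open>G\<close>, thick and thin parts of members can be separated. The thick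
  parts have a largest one, \<open>S\<close>, all of whose subsets occur, and the members avoiding
  \<open>T\<close> form \<open>W\<close>.\<close>

lemma closed_subset_is_box:
  assumes G: "closed_subset H G"
  shows "\<exists>S W. S \<subseteq> T \<and> xor_space N W \<and> G = x ` box S W"
proof -
  define F where "F = {A \<in> Pow I. x A \<in> G}"
  have G_eq: "G = x ` F"
  proof
    show "G \<subseteq> x ` F"
    proof
      fix a assume a: "a \<in> G"
      then obtain A where "A \<subseteq> I" "a = x A"
        using closed_subset_carrier[OF G] x_surj by blast
      with a show "a \<in> x ` F"
        by (auto simp: F_def)
    qed
  qed (auto simp: F_def)
  have F_sub: "A \<subseteq> I" if "A \<in> F" for A
    using that by (simp add: F_def)
  have finF: "finite F"
    by (rule finite_subset[of _ "Pow I"]) (auto simp: F_def)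
  have F_mult: "C \<in> F"
    if AB: "A \<in> F" "B \<in> F" and C: "sym_diff A B \<subseteq> C" "C \<subseteq> sym_diff A B \<union> (A \<inter> B \<inter> T)" for A B C
  proof -
    have "C \<subseteq> I"
      using C AB F_sub by blast
    then have "x C \<in> hmult H (x A) (x B)"
      using x_mem_hmult[of A B C] AB C F_sub by simp
    then show ?thesis
      using closed_subset_hmult[OF G, of "x A" "x B"] AB \<open>C \<subseteq> I\<close> by (auto simp: F_def)
  qed
  have empty: "{} \<in> F"
    using closed_subset_neutral[OF G] by (simp add: F_def)
  \<comment> \<open>The square of \<open>A\<close> contains every subset of its thick part.\<close>
  have thick_part: "B \<in> F" if "A \<in> F" "B \<subseteq> A \<inter> T" for A B
    using F_mult[OF that(1,1), of B] that by simp
  \<comment> \<open>The symmetric difference of \<open>A\<close> and \<open>A \<inter> T\<close> is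
    \<open>A - T\<close>.\<close>
  have thin_part: "A - T \<in> F" if "A \<in> F" for A
    using F_mult[OF that thick_part[OF that subset_refl], of "A - T"] by blast
  \<comment> \<open>For sets inside \<open>T\<close>, the union is the largest set in the
    product.\<close>
  have union: "A \<union> B \<in> F" if "A \<in> F" "B \<in> F" "A \<subseteq> T" "B \<subseteq> T" for A B
    using F_mult[OF that(1,2), of "A \<union> B"] that(3,4) by blast
  define S where "S = \<Union>((\<lambda>A. A \<inter> T) ` F)"
  define W where "W = {A \<in> F. A \<inter> T = {}}"
  have S_sub: "S \<subseteq> T"
    by (auto simp: S_def)
  \<comment> \<open>Since \<open>F\<close> is finite, repeated unions show that \<open>S\<close>
    itself belongs to \<open>F\<close>.\<close>
  have "\<Union>((\<lambda>A. A \<inter> T) ` X) \<in> F" if "finite X" "X \<subseteq> F" for X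
    using that
  proof (induction X)
    case (insert A X)
    let ?B = "\<Union>((\<lambda>A. A \<inter> T) ` X)"
    have "?B \<in> F" "A \<inter> T \<in> F"
      using insert thick_part[of A "A \<inter> T"] by auto
    moreover have "?B \<subseteq> T" "A \<inter> T \<subseteq> T"
      by blast+
    ultimately have "(A \<inter> T) \<union> ?B \<in> F"
      by (intro union)
    then show ?case
      by simp
  qed (simp add: empty)
  then have S_F: "S \<in> F"
    using finF by (simp add: S_def)
  have W_space: "xor_space N W"
    unfolding xor_space_def
  proof (intro conjI ballI)
    show "W \<subseteq> Pow N"
    proof
      fix A assume "A \<in> W"
      then show "A \<in> Pow N"
        using F_sub[of A] unfolding W_def N_def by blast
    qed
    show "{} \<in> W"
      using empty by (simp add: W_def)
    fix U V assume UV: "U \<in> W" "V \<in> W"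
    then have UV_F: "U \<in> F" "V \<in> F"
      by (auto simp: W_def)
    have "sym_diff U V \<in> F"
      using F_mult[OF UV_F, of "sym_diff U V"] by blast
    then show "sym_diff U V \<in> W"
      using UV unfolding W_def by blast
  qed
  have "F = box S W"
  proof (intro equalityI subsetI)
    fix A assume A: "A \<in> F"
    have "A \<inter> T \<subseteq> S" "(A - T) \<inter> T = {}"
      using A by (auto simp: S_def)
    then show "A \<in> box S W"
      using thin_part[OF A] F_sub[OF A] by (simp add: box_def W_def)
  next
    fix A assume A: "A \<in> box S W"
    have "A \<inter> T \<in> F"
      using A S_sub by (intro thick_part[OF S_F]) (auto simp: box_def)
    moreover have "A - T \<in> F"
      using A by (simp add: box_def W_def)
    \<comment> \<open>The two parts are disjoint, so \<open>A\<close> is their symmetric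
      difference.\<close>
    ultimately show "A \<in> F"
      using F_mult[of "A \<inter> T" "A - T" A] by blast
  qed
  then show ?thesis
    using S_sub W_space G_eq by blast
qed

lemma inj_x_box: "inj_on x (box S W)"
  using bij_betw_imp_inj_on[OF bij_x] box_subset by (rule inj_on_subset)

lemma mem_box_thick: "S \<subseteq> T \<Longrightarrow> xor_space N W \<Longrightarrow> S \<in> box S W"
proof -
  assume S: "S \<subseteq> T" and W: "xor_space N W"
  have "S - T = {}" "S \<subseteq> I"
    using S T_subset by blast+
  then show "S \<in> box S W"
    using xor_space_empty[OF W] by (simp only: box_def mem_Collect_eq) blast
qed

lemma box_thin:
  assumes "xor_space N W"
  shows "{A \<in> box S W. A \<inter> T = {}} = W"
proof (intro equalityI subsetI)
  fix A assume "A \<in> {A \<in> box S W. A \<inter> T = {}}"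
  then show "A \<in> W"
    by (auto simp: box_def Diff_triv)
next
  fix A assume A: "A \<in> W"
  then have "A \<subseteq> I" "A \<inter> T = {}"
    using xor_space_subset[OF assms] by (auto simp: N_def)
  then show "A \<in> {A \<in> box S W. A \<inter> T = {}}"
    using A by (simp add: box_def Diff_triv)
qed

lemma box_empty:
  assumes "xor_space N W"
  shows "box {} W = W"
  using box_thin[OF assms, of "{}"] by (auto simp: box_def)

text \<open>Both parameters can be recovered from the box: \<open>S\<close> is its largest thick
  part, and \<open>W\<close> consists of its members that avoid \<open>T\<close>.\<close>

lemma x_box_inject:
  assumes "S \<subseteq> T" "xor_space N W" "S' \<subseteq> T" "xor_space N W'" "x ` box S W = x ` box S' W'"
  shows "S = S' \<and> W = W'"
proof -
  have eq: "box S W = box S' W'"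
    using assms(5) bij_x box_subset by (metis bij_betw_def inj_on_image_eq_iff)
  have "S \<in> box S' W'" "S' \<in> box S W"
    using mem_box_thick assms eq by auto
  then have "S = S'"
    using assms(1,3) unfolding box_def by blast
  moreover have "W = W'"
    using box_thin[OF assms(2), of S] box_thin[OF assms(4), of S'] eq by simp
  ultimately show ?thesis ..
qed

lemma card_x_box:
  assumes S: "S \<subseteq> T" and W: "xor_space N W"
  shows "card (x ` box S W) = 2 ^ card S * card W"
proof -
  have "bij_betw (\<lambda>A. (A \<inter> T, A - T)) (box S W) (Pow S \<times> W)"
  proof (rule bij_betwI')
    show "(A \<inter> T, A - T) = (B \<inter> T, B - T) \<longleftrightarrow> A = B" for A B
      by blast
    show "(A \<inter> T, A - T) \<in> Pow S \<times> W" if "A \<in> box S W" for A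
      using that by (simp add: box_def)
    show "\<exists>A\<in>box S W. BV = (A \<inter> T, A - T)" if SW: "BV \<in> Pow S \<times> W" for BV
    proof -
      obtain B V where BV: "BV = (B, V)" "B \<subseteq> S" "V \<in> W"
        using SW by blast
      have "V \<subseteq> I" "V \<inter> T = {}"
        using BV xor_space_subset[OF W] by (auto simp: N_def)
      then have "(B \<union> V) \<inter> T = B" "(B \<union> V) - T = V" "B \<union> V \<subseteq> I"
        using BV S T_subset by blast+
      then show ?thesis
        using BV by (intro bexI[of _ "B \<union> V"]) (auto simp: box_def)
    qed
  qed
  then have "card (box S W) = card (Pow S \<times> W)"
    by (rule bij_betw_same_card)
  also have "\<dots> = 2 ^ card S * card W"
    using finite_subset[OF S finite_T] by (simp add: card_cartesian_product card_Pow)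
  finally show ?thesis
    by (simp add: card_image inj_x_box)
qed

section \<open>Invariants of closed subsets\<close>

lemma thick_q_iff: "i \<in> I \<Longrightarrow> thick H (q i) \<longleftrightarrow> i \<in> T"
  by (simp add: T_def)

lemma card_q_image: "A \<subseteq> I \<Longrightarrow> card (q ` A) = card A"
  using inj_q by (auto intro: card_image inj_on_subset)

lemma p_sharp_eq: "p_sharp H p q = card T"
proof -
  have "{a \<in> q ` I. thick H a} = q ` T"
    using thick_q_iff T_subset by blast
  then show ?thesis
    using card_q_image[OF T_subset] by (simp add: p_sharp_def)
qed

lemma card_N: "card N = p - p_sharp H p q"
  using T_subset finite_T by (simp add: N_def p_sharp_eq card_Diff_subset)

lemma s_elem_x:
  assumes A: "A \<subseteq> I"
  shows "s_elem H p q (x A) = card (A \<inter> T)"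
proof -
  have "support H p (\<lambda>i. closed_gen H (q i)) (x A) = word A ` I - {e}"
    unfolding support_def components_x by simp
  also have "\<dots> = q ` A"
    using A q_neq by (force simp: word_def split: if_splits)
  finally have "support H p (\<lambda>i. closed_gen H (q i)) (x A) = q ` A" .
  moreover have "{b \<in> q ` A. thick H b} = q ` (A \<inter> T)"
    using thick_q_iff A by blast
  ultimately show ?thesis
    using card_q_image[of "A \<inter> T"] A by (simp add: s_elem_def le_infI1)
qed

text \<open>The thick part of a member lies in \<open>S\<close>, and the bound is attained at
  \<open>x S\<close>.\<close>

lemma s_set_x_box:
  assumes S: "S \<subseteq> T" and W: "xor_space N W"
  shows "s_set H p q (x ` box S W) = card S"
proof -
  have "finite (box S W)"
    by (rule finite_subset[OF box_subset]) simp
  moreover have "s_elem H p q (x A) \<le> card S" if "A \<in> box S W" for A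
  proof -
    have "A \<subseteq> I" "A \<inter> T \<subseteq> S" "finite S"
      using that S finite_T finite_subset by (auto simp: box_def)
    then show ?thesis
      by (simp add: s_elem_x card_mono)
  qed
  moreover have "s_elem H p q (x S) = card S"
    using S T_subset s_elem_x[of S] by (auto simp: Int_absorb2)
  ultimately show ?thesis
    unfolding s_set_def using mem_box_thick[OF S W] by (intro Max_eqI) (auto intro: rev_image_eqI)
qed

lemma hmult_x_thin:
  assumes "U \<subseteq> N" "V \<subseteq> N"
  shows "hmult H (x U) (x V) = {x (sym_diff U V)}"
proof -
  have "U \<subseteq> I" "V \<subseteq> I" "U \<inter> V \<inter> T = {}"
    using assms by (auto simp: N_def)
  then have "hmult H (x U) (x V) = x ` {C. sym_diff U V \<subseteq> C \<and> C \<subseteq> sym_diff U V}"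
    by (simp add: hmult_x)
  also have "{C. sym_diff U V \<subseteq> C \<and> C \<subseteq> sym_diff U V} = {sym_diff U V}"
    by blast
  finally show ?thesis
    by simp
qed

text \<open>On subsets of \<open>N\<close> the product is single-valued and equals the symmetric
  difference, so \<open>W\<close> yields an elementary abelian 2-group of order
  \<open>2 ^ n\<close>.\<close>

lemma two_rank_thin_group:
  assumes W: "xor_space N W" and card: "card W = 2 ^ n"
  shows "two_rank (thin_group H (x ` W)) = n"
proof (rule two_rank_eq)
  let ?G = "thin_group H (x ` W)"
  have carrier: "carrier ?G = (\<lambda>U. {x U}) ` W" and one: "\<one>\<^bsub>?G\<^esub> = {x {}}"
    by (auto simp: thin_group_def)
  have W_N: "U \<subseteq> N" if "U \<in> W" for U
    using that xor_space_subset[OF W] by blast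
  have mult: "{x U} \<otimes>\<^bsub>?G\<^esub> {x V} = {x (sym_diff U V)}" if "U \<in> W" "V \<in> W" for U V
    using that by (simp add: thin_group_def hmult_x_thin W_N)
  have sym: "sym_diff U V \<in> W" if "U \<in> W" "V \<in> W" for U V
    using xor_space_sym_diff[OF W] that .
  have "comm_group ?G"
  proof (rule comm_groupI)
    show "a \<otimes>\<^bsub>?G\<^esub> b \<in> carrier ?G" if ab: "a \<in> carrier ?G" "b \<in> carrier ?G" for a b
    proof -
      obtain U V where "U \<in> W" "V \<in> W" "a = {x U}" "b = {x V}"
        using ab unfolding carrier by blast
      then show ?thesis
        unfolding carrier using mult sym by simp
    qed
    show "\<one>\<^bsub>?G\<^esub> \<in> carrier ?G"
      unfolding carrier one using xor_space_empty[OF W] by blast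
    show "a \<otimes>\<^bsub>?G\<^esub> b \<otimes>\<^bsub>?G\<^esub> c = a \<otimes>\<^bsub>?G\<^esub> (b \<otimes>\<^bsub>?G\<^esub> c)"
      if abc: "a \<in> carrier ?G" "b \<in> carrier ?G" "c \<in> carrier ?G" for a b c
    proof -
      obtain A B C where ABC: "A \<in> W" "B \<in> W" "C \<in> W" "a = {x A}" "b = {x B}" "c = {x C}"
        using abc unfolding carrier by blast
      moreover have "sym_diff (sym_diff A B) C = sym_diff A (sym_diff B C)"
        by blast
      ultimately show ?thesis
        by (simp only: mult sym)
    qed
    show "a \<otimes>\<^bsub>?G\<^esub> b = b \<otimes>\<^bsub>?G\<^esub> a" if ab: "a \<in> carrier ?G" "b \<in> carrier ?G" for a b
    proof -
      obtain A B where "A \<in> W" "B \<in> W" "a = {x A}" "b = {x B}"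
        using ab unfolding carrier by blast
      then show ?thesis
        by (simp add: mult Un_commute)
    qed
    show "\<one>\<^bsub>?G\<^esub> \<otimes>\<^bsub>?G\<^esub> a = a" if a: "a \<in> carrier ?G" for a
    proof -
      obtain A where "A \<in> W" "a = {x A}"
        using a unfolding carrier by blast
      then show ?thesis
        unfolding one using mult[of "{}" A] xor_space_empty[OF W] by simp
    qed
    show "\<exists>b\<in>carrier ?G. b \<otimes>\<^bsub>?G\<^esub> a = \<one>\<^bsub>?G\<^esub>" if a: "a \<in> carrier ?G" for a
    proof -
      obtain A where "A \<in> W" "a = {x A}"
        using a unfolding carrier by blast
      then show ?thesis
        using mult[of A A] a unfolding one by auto
    qed
  qed
  moreover have "a \<otimes>\<^bsub>?G\<^esub> a = \<one>\<^bsub>?G\<^esub>" if "a \<in> carrier ?G" for a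
    using that mult unfolding carrier one by auto
  ultimately show "elementary_abelian_2_group ?G"
    by (simp add: elementary_abelian_2_group_def)
  have "inj_on (\<lambda>U. {x U}) W"
  proof (rule inj_onI)
    fix U V assume "U \<in> W" "V \<in> W" "{x U} = {x V}"
    moreover from this have "U \<subseteq> I" "V \<subseteq> I"
      using W_N by (auto simp: N_def)
    ultimately show "U = V"
      using x_eq_iff by simp
  qed
  then show "card (carrier ?G) = 2 ^ n"
    unfolding carrier using card by (simp add: card_image)
qed

text \<open>A closed subset with thick part \<open>S\<close> contains \<open>x S\<close>, which is
  thin only for empty \<open>S\<close>.\<close>

lemma thin_closed_subset_iff:
  "thin_closed_subset H G \<longleftrightarrow> (\<exists>W. xor_space N W \<and> G = x ` W)"
proof
  assume "thin_closed_subset H G"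
  then have G: "closed_subset H G" and thin: "\<And>a. a \<in> G \<Longrightarrow> thin H a"
    by (auto simp: thin_closed_subset_def)
  obtain S W where SW: "S \<subseteq> T" "xor_space N W" "G = x ` box S W"
    using closed_subset_is_box[OF G] by blast
  have "thin H (x S)"
    using SW mem_box_thick[of S W] by (intro thin) simp
  then have "S = {}"
    using SW(1) T_subset thin_x_iff[of S] by blast
  then show "\<exists>W. xor_space N W \<and> G = x ` W"
    using SW box_empty by auto
next
  assume "\<exists>W. xor_space N W \<and> G = x ` W"
  then obtain W where W: "xor_space N W" "G = x ` W"
    by blast
  have "closed_subset H G"
    using closed_subset_box[of "{}" W] W box_empty by simp
  moreover have "thin H (x U)" if "U \<in> W" for U
  proof -
    have "U \<subseteq> N"
      using that xor_space_subset[OF W(1)] by blast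
    then show ?thesis
      using thin_x_iff[of U] by (auto simp: N_def)
  qed
  ultimately show "thin_closed_subset H G"
    using W by (auto simp: thin_closed_subset_def)
qed

text \<open>The maximum is attained at the image of \<open>W\<close>: the index sets of a thin
  closed subset avoid \<open>T\<close>, and those in the box that do so form \<open>W\<close>. The
  power of two spares a separate notion of dimension.\<close>

lemma r2_x_box:
  assumes S: "S \<subseteq> T" and W: "xor_space N W"
  shows "2 ^ r2 H (x ` box S W) = card W"
proof -
  let ?R = "{two_rank (thin_group H G) | G. thin_closed_subset H G \<and> G \<subseteq> x ` box S W}"
  obtain n where n: "card W = 2 ^ n"
    using card_xor_space[OF finite_N W] .
  have le: "k \<le> n" if k: "k \<in> ?R" for k
  proof -
    obtain V where V: "xor_space N V" "x ` V \<subseteq> x ` box S W" "k = two_rank (thin_group H (x ` V))"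
      using k unfolding thin_closed_subset_iff by blast
    have V_box: "A \<inter> T = {}" "A \<subseteq> I" if "A \<in> V" for A
      using that xor_space_subset[OF V(1)] by (auto simp: N_def)
    have "V \<subseteq> box S W"
    proof
      fix A assume A: "A \<in> V"
      then obtain B where B: "B \<in> box S W" "x A = x B"
        using V(2) by blast
      then have "A = B"
        using x_eq_iff[of A B] V_box(2)[OF A] box_subset by blast
      then show "A \<in> box S W"
        using B by simp
    qed
    then have "V \<subseteq> {A \<in> box S W. A \<inter> T = {}}"
      using V_box(1) by blast
    then have "V \<subseteq> W"
      by (simp only: box_thin[OF W])
    obtain m where m: "card V = 2 ^ m"
      using card_xor_space[OF finite_N V(1)] .
    then have "k = m"
      using V two_rank_thin_group by simp
    have "card V \<le> card W"
      using \<open>V \<subseteq> W\<close> finite_xor_space[OF finite_N W] by (rule card_mono[rotated])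
    then show ?thesis
      using m n \<open>k = m\<close> by simp
  qed
  have "n \<in> ?R"
  proof -
    have "W \<subseteq> box S W"
      using box_thin[OF W, of S] by blast
    then have "x ` W \<subseteq> x ` box S W"
      by (rule image_mono)
    moreover have "thin_closed_subset H (x ` W)"
      unfolding thin_closed_subset_iff using W by blast
    ultimately show ?thesis
      using two_rank_thin_group[OF W n] by blast
  qed
  moreover have "finite ?R"
    using le by (meson finite_nat_set_iff_bounded_le)
  ultimately have "r2 H (x ` box S W) = n"
    unfolding r2_def using le by (intro Max_eqI) auto
  then show ?thesis
    using n by simp
qed

section \<open>Isomorphisms\<close>

text \<open>Isomorphisms preserve thinness, and the thin elements are the image of \<open>W\<close>;
  this gives \<open>card W\<close>. The total cardinality then gives \<open>card S\<close>.\<close>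

lemma hyper_iso_imp:
  assumes SW: "S \<subseteq> T" "xor_space N W" and SW': "S' \<subseteq> T" "xor_space N W'"
    and iso: "hyper_iso H (x ` box S W) (x ` box S' W')"
  shows "card S = card S' \<and> card W = card W'"
proof -
  let ?F = "x ` box S W" and ?G = "x ` box S' W'"
  obtain \<alpha> where hom: "\<alpha> \<in> hyper_hom H ?F ?G" and bij: "bij_betw \<alpha> ?F ?G"
    using iso unfolding hyper_iso_def by blast
  have \<alpha>_e: "\<alpha> e = e"
    using hom by (simp add: hyper_hom_def)
  have \<alpha>: "\<alpha> ` hmult H a b = hmult H (\<alpha> a) (\<alpha> b)" if "a \<in> ?F" "b \<in> ?F" for a b
    using hom that unfolding hyper_hom_def mem_Collect_eq by blast
  \<comment> \<open>Every element is its own star, so thinness is a condition on the square, which a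
    homomorphism can transport.\<close>
  have thin_iff: "thin H a \<longleftrightarrow> hmult H a a = {e}" if "a \<in> x ` box S W" for a S W
    using that star_x by (auto simp: thin_def box_def)
  have thin_part: "{a \<in> x ` box S W. thin H a} = x ` W" if "xor_space N W" for S W
  proof -
    have "{a \<in> x ` box S W. thin H a} = x ` {A \<in> box S W. A \<inter> T = {}}"
    proof (intro equalityI subsetI)
      fix a assume "a \<in> {a \<in> x ` box S W. thin H a}"
      then obtain A where "A \<in> box S W" "a = x A" "thin H (x A)"
        by blast
      then show "a \<in> x ` {A \<in> box S W. A \<inter> T = {}}"
        using thin_x_iff[of A] by (simp add: box_def)
    next
      fix a assume "a \<in> x ` {A \<in> box S W. A \<inter> T = {}}"
      then obtain A where "A \<in> box S W" "a = x A" "A \<inter> T = {}"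
        by blast
      then show "a \<in> {a \<in> x ` box S W. thin H a}"
        using thin_x_iff[of A] by (simp add: box_def)
    qed
    then show ?thesis
      by (simp only: box_thin[OF that])
  qed
  have card_thin: "card (x ` W) = card W" if "xor_space N W" for W
    using inj_x_box[of "{}" W] box_empty[OF that] by (simp add: card_image)
  have thin_\<alpha>: "thin H (\<alpha> a) \<longleftrightarrow> thin H a" if a: "a \<in> ?F" for a
  proof -
    have "\<alpha> a \<in> ?G"
      using a bij bij_betwE by blast
    then have "thin H (\<alpha> a) \<longleftrightarrow> \<alpha> ` hmult H a a = \<alpha> ` {e}"
      using thin_iff[of "\<alpha> a"] \<alpha>[OF a a] \<alpha>_e by simp
    also have "\<dots> \<longleftrightarrow> hmult H a a = {e}"
    proof (rule inj_on_image_eq_iff)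
      show "inj_on \<alpha> ?F"
        using bij by (simp add: bij_betw_def)
      show "hmult H a a \<subseteq> ?F" "{e} \<subseteq> ?F"
        using closed_subset_hmult[OF closed_subset_box[OF SW] a a]
          closed_subset_neutral[OF closed_subset_box[OF SW]] by simp_all
    qed
    also have "\<dots> \<longleftrightarrow> thin H a"
      using thin_iff[OF a] by simp
    finally show ?thesis .
  qed
  have "bij_betw \<alpha> {a \<in> ?F. thin H a} {a \<in> ?G. thin H a}"
  proof (rule bij_betw_imageI)
    show "inj_on \<alpha> {a \<in> ?F. thin H a}"
      by (rule inj_on_subset[OF bij_betw_imp_inj_on[OF bij]]) blast
    show "\<alpha> ` {a \<in> ?F. thin H a} = {a \<in> ?G. thin H a}"
      unfolding bij_betw_imp_surj_on[OF bij, symmetric] using thin_\<alpha> by blast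
  qed
  then have "bij_betw \<alpha> (x ` W) (x ` W')"
    unfolding thin_part[OF SW(2)] thin_part[OF SW'(2)] .
  then have W_eq: "card W = card W'"
    using bij_betw_same_card card_thin[OF SW(2)] card_thin[OF SW'(2)] by fastforce
  \<comment> \<open>Positivity allows \<open>card W\<close> to be cancelled from the two
    cardinalities.\<close>
  have "card W > 0"
    using finite_xor_space[OF finite_N SW(2)] xor_space_empty[OF SW(2)] by (auto simp: card_gt_0_iff)
  moreover have "2 ^ card S * card W = 2 ^ card S' * card W'"
    using bij_betw_same_card[OF bij] unfolding card_x_box[OF SW] card_x_box[OF SW'] .
  ultimately show ?thesis
    using W_eq by simp
qed

text \<open>A bijection \<open>g\<close> of the thick parts and a linear bijection \<open>h\<close>
  of the thin parts act independently. The thick part of the multiplication rule only involves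
  Boolean operations and inclusions, which any bijection respects; the thin part is addition, which
  \<open>h\<close> respects.\<close>

lemma imp_hyper_iso:
  assumes SW: "S \<subseteq> T" "xor_space N W" and SW': "S' \<subseteq> T" "xor_space N W'"
    and cards: "card S = card S'" "card W = card W'"
  shows "hyper_iso H (x ` box S W) (x ` box S' W')"
proof -
  have "finite S" "finite S'"
    using SW SW' finite_T finite_subset by auto
  then obtain g where g: "bij_betw g S S'"
    using cards finite_same_card_bij by blast
  obtain h where h: "bij_betw h W W'" "xor_hom_on W h"
    using xor_space_iso[OF finite_N SW(2) SW'(2) cards(2)] by blast
  define f where "f A = g ` (A \<inter> T) \<union> h (A - T)" for A
  have f_thick: "f A \<inter> T = g ` (A \<inter> T)" and f_thin: "f A - T = h (A - T)" and f_box: "f A \<in> box S' W'"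
    if A: "A \<in> box S W" for A
  proof -
    have h_W': "h (A - T) \<in> W'"
      using h(1) A bij_betwE by (auto simp: box_def)
    then have h_N: "h (A - T) \<subseteq> N"
      using xor_space_subset[OF SW'(2)] by blast
    have g_S': "g ` (A \<inter> T) \<subseteq> S'"
      using g A unfolding bij_betw_def box_def by blast
    show 1: "f A \<inter> T = g ` (A \<inter> T)" and 2: "f A - T = h (A - T)"
      using h_N g_S' SW'(1) unfolding f_def N_def by blast+
    have "f A \<subseteq> I"
      using h_N g_S' SW'(1) T_subset unfolding f_def N_def by blast
    then show "f A \<in> box S' W'"
      using 1 2 h_W' g_S' by (simp add: box_def)
  qed
  have bij_f: "bij_betw f (box S W) (box S' W')"
  proof (rule bij_betwI')
    fix A B assume AB: "A \<in> box S W" "B \<in> box S W"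
    show "f A = f B \<longleftrightarrow> A = B"
    proof
      assume eq: "f A = f B"
      then have "g ` (A \<inter> T) = g ` (B \<inter> T)" "h (A - T) = h (B - T)"
        using f_thick[OF AB(1)] f_thick[OF AB(2)] f_thin[OF AB(1)] f_thin[OF AB(2)] by auto
      moreover have "A \<inter> T \<subseteq> S" "B \<inter> T \<subseteq> S" "A - T \<in> W" "B - T \<in> W"
        using AB by (auto simp: box_def)
      ultimately have "A \<inter> T = B \<inter> T" "A - T = B - T"
        using inj_on_image_eq_iff[OF bij_betw_imp_inj_on[OF g], of "A \<inter> T" "B \<inter> T"]
          inj_onD[OF bij_betw_imp_inj_on[OF h(1)], of "A - T" "B - T"] by simp_all
      then show "A = B"
        by blast
    qed simp
  next
    show "f A \<in> box S' W'" if "A \<in> box S W" for A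
      using that by (rule f_box)
  next
    fix D assume D: "D \<in> box S' W'"
    then have "D \<inter> T \<subseteq> g ` S" "D - T \<in> h ` W"
      using bij_betw_imp_surj_on[OF g] bij_betw_imp_surj_on[OF h(1)] by (simp_all add: box_def)
    then obtain B V where B: "B \<subseteq> S" "D \<inter> T = g ` B" and V: "V \<in> W" "D - T = h V"
      unfolding subset_image_iff by blast
    have "V \<subseteq> N"
      using V xor_space_subset[OF SW(2)] by blast
    then have split: "(B \<union> V) \<inter> T = B" "(B \<union> V) - T = V" "B \<union> V \<subseteq> I"
      using B SW(1) T_subset unfolding N_def by blast+
    then have "B \<union> V \<in> box S W"
      using B V by (simp add: box_def)
    moreover have "D = f (B \<union> V)"
      unfolding f_def split using B V by blast
    ultimately show "\<exists>A\<in>box S W. D = f A"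
      by blast
  qed
  \<comment> \<open>Both directions matter: one places the image of a product inside the product of
    the images, the other makes this inclusion an equality.\<close>
  have mult_iff: "x (f C) \<in> hmult H (x (f A)) (x (f B)) \<longleftrightarrow> x C \<in> hmult H (x A) (x B)"
    if A: "A \<in> box S W" and B: "B \<in> box S W" and C: "C \<in> box S W" for A B C
  proof -
    \<comment> \<open>The rule splits into an equation between thin parts and an interval for the
      thick part, from the symmetric difference up to the union.\<close>
    have iff: "x C \<in> hmult H (x A) (x B) \<longleftrightarrow> C - T = sym_diff (A - T) (B - T) \<and>
        sym_diff (A \<inter> T) (B \<inter> T) \<subseteq> C \<inter> T \<and> C \<inter> T \<subseteq> (A \<inter> T) \<union> (B \<inter> T)"
      if "A \<subseteq> I" "B \<subseteq> I" "C \<subseteq> I" for A B C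
      unfolding x_mem_hmult[OF that] by blast
    have sub: "A \<inter> T \<subseteq> S" "B \<inter> T \<subseteq> S" "C \<inter> T \<subseteq> S"
      and W_mem: "A - T \<in> W" "B - T \<in> W" "C - T \<in> W"
      and I_sub: "A \<subseteq> I" "B \<subseteq> I" "C \<subseteq> I" "f A \<subseteq> I" "f B \<subseteq> I" "f C \<subseteq> I"
      using A B C f_box by (auto simp: box_def)
    have "sym_diff (A - T) (B - T) \<in> W"
      using xor_space_sym_diff[OF SW(2) W_mem(1,2)] .
    then have "h (C - T) = sym_diff (h (A - T)) (h (B - T)) \<longleftrightarrow> C - T = sym_diff (A - T) (B - T)"
      using xor_hom_onD[OF h(2) W_mem(1,2)] h(1) W_mem(3) unfolding bij_betw_def
      by (metis inj_on_eq_iff)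
    moreover have g_inj: "inj_on g S"
      using g by (simp add: bij_betw_def)
    have sym: "g ` sym_diff (A \<inter> T) (B \<inter> T) = sym_diff (g ` (A \<inter> T)) (g ` (B \<inter> T))"
      using sub inj_on_image_set_diff[OF g_inj, of "A \<inter> T" "B \<inter> T"]
        inj_on_image_set_diff[OF g_inj, of "B \<inter> T" "A \<inter> T"] by (auto simp: image_Un)
    have "sym_diff (A \<inter> T) (B \<inter> T) \<subseteq> S" "(A \<inter> T) \<union> (B \<inter> T) \<subseteq> S"
      using sub by blast+
    then have "sym_diff (g ` (A \<inter> T)) (g ` (B \<inter> T)) \<subseteq> g ` (C \<inter> T)
        \<longleftrightarrow> sym_diff (A \<inter> T) (B \<inter> T) \<subseteq> C \<inter> T"
      "g ` (C \<inter> T) \<subseteq> g ` (A \<inter> T) \<union> g ` (B \<inter> T) \<longleftrightarrow> C \<inter> T \<subseteq> (A \<inter> T) \<union> (B \<inter> T)"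
      unfolding sym[symmetric] image_Un[symmetric]
      using inj_on_image_subset_iff[OF g_inj] sub(3) by auto
    ultimately show ?thesis
      unfolding iff[OF I_sub(1-3)] iff[OF I_sub(4-6)] f_thick[OF A] f_thick[OF B] f_thick[OF C]
        f_thin[OF A] f_thin[OF B] f_thin[OF C] by simp
  qed
  \<comment> \<open>This is \<open>f\<close> carried from index sets to elements along the
    encoding.\<close>
  define \<alpha> where "\<alpha> a = x (f (the_inv_into (box S W) x a))" for a
  have \<alpha>_x: "\<alpha> (x A) = x (f A)" if "A \<in> box S W" for A
    using that by (simp add: \<alpha>_def the_inv_into_f_f inj_x_box)
  have "bij_betw \<alpha> (x ` box S W) (x ` box S' W')"
  proof -
    have "bij_betw (x \<circ> (f \<circ> the_inv_into (box S W) x)) (x ` box S W) (x ` box S' W')"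
      using bij_betw_trans[OF bij_betw_trans[OF bij_betw_the_inv_into bij_f]]
        inj_on_imp_bij_betw[OF inj_x_box] by blast
    moreover have "x \<circ> (f \<circ> the_inv_into (box S W) x) = \<alpha>"
      by (auto simp: \<alpha>_def)
    ultimately show ?thesis
      by simp
  qed
  moreover have "\<alpha> \<in> hyper_hom H (x ` box S W) (x ` box S' W')"
    unfolding hyper_hom_def
  proof (intro CollectI conjI ballI)
    show "\<alpha> ` x ` box S W \<subseteq> x ` box S' W'"
      using \<alpha>_x f_box by auto
    have "{} \<in> box S W"
      using xor_space_empty[OF SW(2)] by (simp add: box_def)
    moreover have "f {} = {}"
      using xor_hom_on_empty[OF h(2)] xor_space_empty[OF SW(2)] by (simp add: f_def)
    ultimately show "\<alpha> e = e"
      using \<alpha>_x[of "{}"] by simp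
  next
    fix a b assume "a \<in> x ` box S W" "b \<in> x ` box S W"
    then obtain A B where A: "A \<in> box S W" "a = x A" and B: "B \<in> box S W" "b = x B"
      by blast
    have ab: "hmult H a b \<subseteq> x ` box S W" "hmult H (x (f A)) (x (f B)) \<subseteq> x ` box S' W'"
      using A B f_box closed_subset_hmult[OF closed_subset_box[OF SW]]
        closed_subset_hmult[OF closed_subset_box[OF SW']] by simp_all
    have "\<alpha> ` hmult H a b = hmult H (x (f A)) (x (f B))"
    proof (intro equalityI subsetI)
      fix d assume "d \<in> \<alpha> ` hmult H a b"
      then obtain C where "C \<in> box S W" "x C \<in> hmult H a b" "d = \<alpha> (x C)"
        using ab(1) by blast
      then show "d \<in> hmult H (x (f A)) (x (f B))"
        using mult_iff[OF A(1) B(1)] \<alpha>_x A B by simp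
    next
      fix d assume d: "d \<in> hmult H (x (f A)) (x (f B))"
      then obtain D where D: "D \<in> box S' W'" "d = x D"
        using ab(2) by blast
      \<comment> \<open>Surjectivity of \<open>f\<close> supplies a preimage, which
        \<open>mult_iff\<close> places in the original product.\<close>
      then obtain C where C: "C \<in> box S W" "D = f C"
        using bij_f unfolding bij_betw_def by blast
      then have "x C \<in> hmult H a b"
        using mult_iff[OF A(1) B(1)] d D A B by simp
      then show "d \<in> \<alpha> ` hmult H a b"
        using C D \<alpha>_x by (metis imageI)
    qed
    then show "\<alpha> ` hmult H a b = hmult H (\<alpha> a) (\<alpha> b)"
      using \<alpha>_x A B by simp
  qed
  ultimately show ?thesis
    unfolding hyper_iso_def by blast
qed

section \<open>Counting\<close>

text \<open>The exponent in the last equation ties the three invariants together: any two of them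
  determine the third.\<close>

lemma box_cases:
  assumes "closed_subset H G"
  obtains S W where "S \<subseteq> T" "xor_space N W" "G = x ` box S W" "s_set H p q G = card S"
    "2 ^ r2 H G = card W" "card G = 2 ^ (s_set H p q G + r2 H G)"
proof -
  obtain S W where SW: "S \<subseteq> T" "xor_space N W" "G = x ` box S W"
    using closed_subset_is_box[OF assms] by blast
  moreover have s: "s_set H p q G = card S" and r: "2 ^ r2 H G = card W"
    unfolding SW(3) using s_set_x_box[OF SW(1,2)] r2_x_box[OF SW(1,2)] .
  moreover have "card G = 2 ^ (s_set H p q G + r2 H G)"
    using card_x_box[OF SW(1,2)] by (simp add: power_add s r flip: SW(3))
  ultimately show thesis
    by (rule that)
qed

lemma hyper_iso_iff:
  assumes F: "closed_subset H F" and G: "closed_subset H G"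
  shows "hyper_iso H F G \<longleftrightarrow> s_set H p q F = s_set H p q G \<and> r2 H F = r2 H G"
proof -
  obtain S W where SW: "S \<subseteq> T" "xor_space N W" "F = x ` box S W" "s_set H p q F = card S"
      "2 ^ r2 H F = card W"
    using F by (rule box_cases)
  obtain S' W' where SW': "S' \<subseteq> T" "xor_space N W'" "G = x ` box S' W'" "s_set H p q G = card S'"
      "2 ^ r2 H G = card W'"
    using G by (rule box_cases)
  have "hyper_iso H F G \<longleftrightarrow> card S = card S' \<and> card W = card W'"
    using hyper_iso_imp[OF SW(1,2) SW'(1,2)] imp_hyper_iso[OF SW(1,2) SW'(1,2)] SW(3) SW'(3) by blast
  moreover have "card W = card W' \<longleftrightarrow> r2 H F = r2 H G"
    by (simp flip: SW(5) SW'(5))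
  ultimately show ?thesis
    by (simp add: SW(4) SW'(4))
qed

lemma iso_rel_eq:
  "iso_rel H = {(F, G). F \<in> closed_subsets H \<and> G \<in> closed_subsets H \<and>
    (s_set H p q F, r2 H F) = (s_set H p q G, r2 H G)}"
  using hyper_iso_iff by (auto simp: iso_rel_def closed_subsets_def)

text \<open>The two invariants are independent. A pair (s, r) is realised by any
  \<open>S \<subseteq> T\<close> of size s together with the space \<open>Pow R\<close> for any
  \<open>R \<subseteq> N\<close> of size r.\<close>

lemma invariants_range:
  "(\<lambda>F. (s_set H p q F, r2 H F)) ` closed_subsets H = {0..card T} \<times> {0..card N}"
proof (intro equalityI subsetI)
  fix k assume "k \<in> (\<lambda>F. (s_set H p q F, r2 H F)) ` closed_subsets H"
  then obtain F where F: "closed_subset H F" "k = (s_set H p q F, r2 H F)"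
    by (auto simp: closed_subsets_def)
  obtain S W where SW: "S \<subseteq> T" "xor_space N W" "s_set H p q F = card S" "2 ^ r2 H F = card W"
    using F(1) by (rule box_cases)
  have "card W \<le> card (Pow N)"
    using xor_space_subset[OF SW(2)] finite_N by (intro card_mono) auto
  then have "2 ^ r2 H F \<le> (2::nat) ^ card N"
    by (simp add: SW(4) card_Pow finite_N)
  moreover have "card S \<le> card T"
    using SW(1) finite_T by (intro card_mono)
  ultimately show "k \<in> {0..card T} \<times> {0..card N}"
    by (simp add: F(2) SW(3))
next
  fix k assume "k \<in> {0..card T} \<times> {0..card N}"
  then obtain s r where sr: "k = (s, r)" "s \<le> card T" "r \<le> card N"
    by auto
  obtain S where S: "S \<subseteq> T" "card S = s"
    using obtain_subset_with_card_n[OF sr(2)] by blast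
  obtain R where R: "R \<subseteq> N" "card R = r"
    using obtain_subset_with_card_n[OF sr(3)] by blast
  let ?F = "x ` box S (Pow R)"
  have R_space: "xor_space N (Pow R)"
    using R(1) by (rule xor_space_Pow)
  have "finite R"
    using R(1) finite_N by (rule finite_subset)
  then have "(2::nat) ^ r2 H ?F = 2 ^ r"
    using r2_x_box[OF S(1) R_space] R(2) by (simp add: card_Pow)
  then have "k = (s_set H p q ?F, r2 H ?F)"
    using sr(1) s_set_x_box[OF S(1) R_space] S(2) by simp
  moreover have "?F \<in> closed_subsets H"
    using closed_subset_box[OF S(1) R_space] by (simp add: closed_subsets_def)
  ultimately show "k \<in> (\<lambda>F. (s_set H p q F, r2 H F)) ` closed_subsets H"
    by (rule image_eqI)
qed

lemma card_quotient_iso_rel: "card (closed_subsets H // iso_rel H) = (card T + 1) * (card N + 1)"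
  unfolding iso_rel_eq card_quotient_kernel invariants_range by (simp add: card_cartesian_product)

text \<open>The parameters of the members of a class are constrained only by their cardinalities, so
  thick and thin parts can be counted separately.\<close>

lemma iso_class_eq:
  assumes F: "closed_subset H F"
  shows "iso_rel H `` {F} = (\<lambda>(S, W). x ` box S W) `
    ({S. S \<subseteq> T \<and> card S = s_set H p q F} \<times> {W. xor_space N W \<and> card W = 2 ^ r2 H F})"
    (is "_ = ?b ` ?D")
proof (intro equalityI subsetI)
  fix G assume "G \<in> iso_rel H `` {F}"
  then have G: "closed_subset H G" "s_set H p q G = s_set H p q F" "r2 H G = r2 H F"
    by (auto simp: iso_rel_eq closed_subsets_def)
  obtain S W where SW: "S \<subseteq> T" "xor_space N W" "G = x ` box S W" "s_set H p q G = card S"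
      "2 ^ r2 H G = card W"
    using G(1) by (rule box_cases)
  then have "(S, W) \<in> ?D" "G = ?b (S, W)"
    using G(2,3) by simp_all
  then show "G \<in> ?b ` ?D"
    by blast
next
  fix G assume "G \<in> ?b ` ?D"
  then obtain S W where SW: "S \<subseteq> T" "card S = s_set H p q F" "xor_space N W" "card W = 2 ^ r2 H F"
      "G = x ` box S W"
    by auto
  have "closed_subset H G" "s_set H p q G = s_set H p q F" "(2::nat) ^ r2 H G = 2 ^ r2 H F"
    unfolding SW(5) using SW closed_subset_box s_set_x_box r2_x_box by simp_all
  then show "G \<in> iso_rel H `` {F}"
    using F by (simp add: iso_rel_eq closed_subsets_def)
qed

lemma card_iso_class:
  assumes F: "closed_subset H F"
  shows "card (iso_rel H `` {F}) = (card T choose s_set H p q F) * gauss_coeff (card N) (r2 H F)"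
proof -
  let ?D = "{S. S \<subseteq> T \<and> card S = s_set H p q F} \<times> {W. xor_space N W \<and> card W = 2 ^ r2 H F}"
  have "inj_on (\<lambda>(S, W). x ` box S W) ?D"
  proof (rule inj_onI)
    fix d d' assume "d \<in> ?D" "d' \<in> ?D"
      and eq: "(\<lambda>(S, W). x ` box S W) d = (\<lambda>(S, W). x ` box S W) d'"
    then obtain S W S' W' where d: "d = (S, W)" "S \<subseteq> T" "xor_space N W"
        and d': "d' = (S', W')" "S' \<subseteq> T" "xor_space N W'"
      by blast
    show "d = d'"
      using x_box_inject[OF d(2,3) d'(2,3)] eq unfolding d(1) d'(1) by simp
  qed
  then have "card (iso_rel H `` {F}) = card ?D"
    unfolding iso_class_eq[OF F] by (rule card_image)
  also have "\<dots> = (card T choose s_set H p q F) * gauss_coeff (card N) (r2 H F)"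
    by (simp add: card_cartesian_product n_subsets[OF finite_T] card_xor_spaces[OF finite_N])
  finally show ?thesis .
qed

end

theorem theorem4p7:
  fixes H :: "('a, 'b) hyperstructure_scheme" and p :: nat and q :: "nat \<Rightarrow> 'a"
  assumes "elementary_abelian_2_hypergroup H p q"
  shows
    "(\<forall>F G. closed_subset H F \<longrightarrow> closed_subset H G \<longrightarrow>
        (hyper_iso H F G \<longleftrightarrow>
           (s_set H p q F = s_set H p q G \<and> r2 H F = r2 H G) \<or>
           (s_set H p q F = s_set H p q G \<and> card F = card G) \<or>
           (r2 H F = r2 H G \<and> card F = card G))) \<and>
     int (card (closed_subsets H // iso_rel H)) =
        int p * int (p_sharp H p q) - (int (p_sharp H p q))\<^sup>2 + int p + 1 \<and>
     (\<forall>F. closed_subset H F \<longrightarrow>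
        card (iso_rel H `` {F}) =
          (p_sharp H p q choose s_set H p q F) * gauss_coeff (p - p_sharp H p q) (r2 H F))"
proof -
  interpret elementary_abelian_2_hyp H p q
    using assms by unfold_locales
  have iso: "hyper_iso H F G \<longleftrightarrow>
      (s_set H p q F = s_set H p q G \<and> r2 H F = r2 H G) \<or>
      (s_set H p q F = s_set H p q G \<and> card F = card G) \<or>
      (r2 H F = r2 H G \<and> card F = card G)"
    if F: "closed_subset H F" and G: "closed_subset H G" for F G
  proof -
    have "card F = 2 ^ (s_set H p q F + r2 H F)" "card G = 2 ^ (s_set H p q G + r2 H G)"
      using box_cases[OF F] box_cases[OF G] by metis+
    \<comment> \<open>Equal cardinality means equal sums of the two invariants, so any two of the
      three equalities imply the remaining one.\<close>
    then have "card F = card G \<longleftrightarrow> s_set H p q F + r2 H F = s_set H p q G + r2 H G"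
      by simp
    then show ?thesis
      unfolding hyper_iso_iff[OF F G] by auto
  qed
  \<comment> \<open>With \<open>t \<le> p\<close> the truncated subtraction is a genuine one, and
    the product can be expanded over the integers.\<close>
  have count: "int ((t + 1) * (p - t + 1)) = int p * int t - (int t)\<^sup>2 + int p + 1" if "t \<le> p" for t
    using le_Suc_ex[OF that] by (auto simp: algebra_simps power2_eq_square)
  have "p_sharp H p q \<le> p"
    using card_mono[OF _ T_subset] by (simp add: p_sharp_eq)
  then have "int (card (closed_subsets H // iso_rel H)) =
      int p * int (p_sharp H p q) - (int (p_sharp H p q))\<^sup>2 + int p + 1"
    unfolding card_quotient_iso_rel card_N p_sharp_eq[symmetric] by (rule count)
  moreover have "card (iso_rel H `` {F}) =
      (p_sharp H p q choose s_set H p q F) * gauss_coeff (p - p_sharp H p q) (r2 H F)"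
    if "closed_subset H F" for F
    using card_iso_class[OF that] by (simp add: card_N p_sharp_eq)
  ultimately show ?thesis
    using iso by blast
qed

end
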